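(* There exists a positive constant $C$ such that for any integer $r \geq 4$ and for every $K_r$-free graph $G$ with maximum degree $\Delta$, \[ \chi_{DP}(G) \leq C\frac{r\Delta \ln \ln \Delta}{\ln \Delta}. \]
   Context: All graphs are finite, undirected and simple; $K_r$ is the complete graph on $r$ vertices. A cover of a graph $G$ is a pair $(L,H)$ where $H$ is a graph and $L\colon V(G)\to 2^{V(H)}$ is such that: (C1) the sets $L(u)$, $u\in V(G)$, partition $V(H)$; (C2) each $H[L(u)]$ is a complete graph; (C3) if there is an edge of $H$ between $L(u)$ and $L(v)$ then $u=v$ or $uv\in E(G)$; (C4) if $uv\in E(G)$ then the set of edges of $H$ between $L(u)$ and $L(v)$ is a matching (possibly empty). The cover is $k$-fold if $|L(u)|=k$ for all $u$. An $(L,H)$-coloring of $G$ is an independent set in $H$ of size $|V(G)|$. The DP-chromatic number $\chi_{DP}(G)$ is the least $k$ such that $G$ has an $(L,H)$-coloring for every $k$-fold cover $(L,H)$ of $G$.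
   Formalization: The formal theorem assumes Δ ≥ 3, since for Δ ≤ 1 the bound is undefined and for Δ = 2 it is negative and so false; graphs have natural numbers as vertices, which covers every finite graph up to isomorphism. *)

theory Defs
  imports Complex_Main "Graph_Theory.Kuratowski"
begin

text \<open>
  Finite, undirected, simple graphs are the \<^locale>\<open>pair_graph\<close>s of the library: an edge
  between \<open>u\<close> and \<open>v\<close> is the pair of arcs \<open>(u, v)\<close>, \<open>(v, u)\<close>, so that
  the degree of a vertex is its out-degree.
\<close>

definition max_degree :: "'a pair_pre_digraph \<Rightarrow> nat" where
  "max_degree G = Max (insert 0 (out_degree (with_proj G) ` pverts G))"

definition complete_free :: "nat \<Rightarrow> 'a pair_pre_digraph \<Rightarrow> bool" where
  "complete_free r G \<longleftrightarrow> \<not> (\<exists>K. subgraph K (with_proj G) \<and> complete_digraph r K)"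

definition independent_set :: "'a pair_pre_digraph \<Rightarrow> 'a set \<Rightarrow> bool" where
  "independent_set G I \<longleftrightarrow> I \<subseteq> pverts G \<and> (\<forall>x\<in>I. \<forall>y\<in>I. (x, y) \<notin> parcs G)"

definition edges_between :: "'a pair_pre_digraph \<Rightarrow> 'a set \<Rightarrow> 'a set \<Rightarrow> 'a set set" where
  "edges_between G A B = {{x, y} | x y. x \<in> A \<and> y \<in> B \<and> (x, y) \<in> parcs G}"

definition matching :: "'a set set \<Rightarrow> bool" where
  "matching M \<longleftrightarrow> pairwise disjnt M"

text \<open>
  In the first condition the sets \<open>L u\<close> may be empty (so this is not \<open>partition_on\<close>).
  Otherwise a nonempty graph would have no \<open>0\<close>-fold cover at all, and its DP-chromatic
  number would be \<open>0\<close>.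
\<close>
definition dp_cover :: "'a pair_pre_digraph \<Rightarrow> ('a \<Rightarrow> 'b set) \<Rightarrow> 'b pair_pre_digraph \<Rightarrow> bool" where
  "dp_cover G L H \<longleftrightarrow> pair_graph H \<and>
     (disjoint_family_on L (pverts G) \<and> (\<Union>u\<in>pverts G. L u) = pverts H) \<and>
     (\<forall>u\<in>pverts G. complete_digraph (card (L u)) (with_proj H \<restriction> L u)) \<and>
     (\<forall>u\<in>pverts G. \<forall>v\<in>pverts G.
        edges_between H (L u) (L v) \<noteq> {} \<longrightarrow> u = v \<or> (u, v) \<in> parcs G) \<and>
     (\<forall>(u, v)\<in>parcs G. matching (edges_between H (L u) (L v)))"

definition fold_cover ::
    "nat \<Rightarrow> 'a pair_pre_digraph \<Rightarrow> ('a \<Rightarrow> 'b set) \<Rightarrow> 'b pair_pre_digraph \<Rightarrow> bool" where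
  "fold_cover k G L H \<longleftrightarrow> dp_cover G L H \<and> (\<forall>u\<in>pverts G. card (L u) = k)"

definition dp_coloring ::
    "'a pair_pre_digraph \<Rightarrow> 'b pair_pre_digraph \<Rightarrow> 'b set \<Rightarrow> bool" where
  "dp_coloring G H I \<longleftrightarrow> independent_set H I \<and> card I = card (pverts G)"

text \<open>
  Cover graphs are finite, hence up to isomorphism their vertices are natural numbers;
  \<open>fold_cover_colorable\<close> below shows that this fixed vertex type loses no generality.
\<close>
definition dp_chromatic_number :: "'a pair_pre_digraph \<Rightarrow> nat" where
  "dp_chromatic_number G =
     (LEAST k. \<forall>(L :: 'a \<Rightarrow> nat set) H. fold_cover k G L H \<longrightarrow> (\<exists>I. dp_coloring G H I))"

definition relabel :: "('a \<Rightarrow> 'b) \<Rightarrow> 'a pair_pre_digraph \<Rightarrow> 'b pair_pre_digraph" where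
  "relabel f G = \<lparr>pverts = f ` pverts G, parcs = map_prod f f ` parcs G\<rparr>"

lemma relabel_simps [simp]:
  "pverts (relabel f G) = f ` pverts G"
  "parcs (relabel f G) = map_prod f f ` parcs G"
  by (auto simp: relabel_def)

lemma pair_graph_iff:
  "pair_graph G \<longleftrightarrow> finite (pverts G) \<and> parcs G \<subseteq> pverts G \<times> pverts G \<and>
     (\<forall>x y. (x, y) \<in> parcs G \<longrightarrow> (y, x) \<in> parcs G \<and> x \<noteq> y)" (is "_ \<longleftrightarrow> ?R")
proof
  assume "pair_graph G"
  then interpret pair_graph G .
  show ?R using pair_finite_verts arcs_symmetric
    by (auto dest: in_arcsD1 in_arcsD2 no_loops')
next
  assume R: ?R
  then have "finite (parcs G)" by (meson finite_SigmaI finite_subset)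
  with R show "pair_graph G"
    by unfold_locales (auto simp: symmetric_def sym_def)
qed

lemma pair_graph_relabel:
  assumes "pair_graph G" "inj_on f (pverts G)"
  shows "pair_graph (relabel f G)"
proof -
  have G: "finite (pverts G)" "parcs G \<subseteq> pverts G \<times> pverts G"
    "\<And>x y. (x, y) \<in> parcs G \<Longrightarrow> (y, x) \<in> parcs G \<and> x \<noteq> y"
    using assms(1) by (auto simp: pair_graph_iff)
  show ?thesis unfolding pair_graph_iff
  proof (intro conjI allI impI)
    fix x y assume "(x, y) \<in> parcs (relabel f G)"
    then obtain a b where ab: "(a, b) \<in> parcs G" "x = f a" "y = f b" by auto
    show "(y, x) \<in> parcs (relabel f G)" using ab G(3)[OF ab(1)] by force
    show "x \<noteq> y" using ab G(2) G(3)[OF ab(1)] assms(2) by (auto dest: inj_onD)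
  qed (use G in auto)
qed

lemma parcs_relabel_iff:
  assumes "pair_graph G" "inj_on f (pverts G)" "x \<in> pverts G" "y \<in> pverts G"
  shows "(f x, f y) \<in> parcs (relabel f G) \<longleftrightarrow> (x, y) \<in> parcs G"
proof
  assume "(f x, f y) \<in> parcs (relabel f G)"
  then obtain a b where "(a, b) \<in> parcs G" "f x = f a" "f y = f b" by auto
  moreover from this(1) have "a \<in> pverts G" "b \<in> pverts G"
    using assms(1) by (auto simp: pair_graph_iff)
  ultimately show "(x, y) \<in> parcs G" using assms(2-) by (metis inj_onD)
qed force

lemma complete_induced_iff:
  assumes "pair_graph H" "A \<subseteq> pverts H"
  shows "complete_digraph (card A) (with_proj H \<restriction> A) \<longleftrightarrow>
           (\<forall>x\<in>A. \<forall>y\<in>A. x \<noteq> y \<longrightarrow> (x, y) \<in> parcs H)"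
proof -
  have H: "finite (pverts H)" "\<And>x y. (x, y) \<in> parcs H \<Longrightarrow> x \<noteq> y"
    using assms(1) by (auto simp: pair_graph_iff)
  have eq: "with_proj H \<restriction> A =
      with_proj \<lparr>pverts = A, parcs = {e \<in> parcs H. fst e \<in> A \<and> snd e \<in> A}\<rparr>"
    by (simp add: induce_subgraph_def with_proj_def)
  have "finite A" using assms(2) H(1) by (rule finite_subset)
  then show ?thesis unfolding eq complete_digraph_pair_def using H(2) by auto
qed

lemma matching_edges_between_iff:
  assumes "A \<inter> B = {}"
  shows "matching (edges_between H A B) \<longleftrightarrow>
     (\<forall>x\<in>A. \<forall>y\<in>B. \<forall>x'\<in>A. \<forall>y'\<in>B. (x, y) \<in> parcs H \<longrightarrow> (x', y') \<in> parcs H \<longrightarrow>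
        (x = x' \<longleftrightarrow> y = y'))" (is "?l \<longleftrightarrow> ?r")
proof
  assume l: ?l
  show ?r
  proof (intro ballI impI)
    fix x y x' y' assume *: "x \<in> A" "y \<in> B" "x' \<in> A" "y' \<in> B" "(x, y) \<in> parcs H" "(x', y') \<in> parcs H"
    then have e: "{x, y} \<in> edges_between H A B" "{x', y'} \<in> edges_between H A B"
      unfolding edges_between_def by blast+
    have "{x, y} = {x', y'} \<or> disjnt {x, y} {x', y'}"
      using pairwiseD[OF l[unfolded matching_def] e] by argo
    moreover have "x \<noteq> y'" "y \<noteq> x'" using * assms by blast+
    ultimately show "x = x' \<longleftrightarrow> y = y'" by (auto simp: disjnt_def doubleton_eq_iff)
  qed
next
  assume r: ?r
  show ?l unfolding matching_def
  proof (rule pairwiseI)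
    fix e e' assume "e \<in> edges_between H A B" "e' \<in> edges_between H A B" "e \<noteq> e'"
    then obtain x y x' y' where *: "x \<in> A" "y \<in> B" "x' \<in> A" "y' \<in> B"
        "(x, y) \<in> parcs H" "(x', y') \<in> parcs H" "e = {x, y}" "e' = {x', y'}"
      unfolding edges_between_def by blast
    with r have "x = x' \<longleftrightarrow> y = y'" by blast
    moreover have "x \<noteq> y'" "y \<noteq> x'" using * assms by blast+
    ultimately show "disjnt e e'" using *(7,8) \<open>e \<noteq> e'\<close> by (auto simp: disjnt_def)
  qed
qed

lemma dp_cover_iff:
  assumes "pair_graph G"
  shows "dp_cover G L H \<longleftrightarrow> pair_graph H \<and>
     disjoint_family_on L (pverts G) \<and> (\<Union>u\<in>pverts G. L u) = pverts H \<and>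
     (\<forall>u\<in>pverts G. \<forall>x\<in>L u. \<forall>y\<in>L u. x \<noteq> y \<longrightarrow> (x, y) \<in> parcs H) \<and>
     (\<forall>u\<in>pverts G. \<forall>v\<in>pverts G. \<forall>x\<in>L u. \<forall>y\<in>L v. (x, y) \<in> parcs H \<longrightarrow> u = v \<or> (u, v) \<in> parcs G) \<and>
     (\<forall>u v. (u, v) \<in> parcs G \<longrightarrow> (\<forall>x\<in>L u. \<forall>y\<in>L v. \<forall>x'\<in>L u. \<forall>y'\<in>L v.
        (x, y) \<in> parcs H \<longrightarrow> (x', y') \<in> parcs H \<longrightarrow> (x = x' \<longleftrightarrow> y = y')))"
proof -
  have G: "u \<in> pverts G" "v \<in> pverts G" "u \<noteq> v" if "(u, v) \<in> parcs G" for u v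
    using assms that by (auto simp: pair_graph_iff)
  have 1: "complete_digraph (card (L u)) (with_proj H \<restriction> L u) \<longleftrightarrow>
      (\<forall>x\<in>L u. \<forall>y\<in>L u. x \<noteq> y \<longrightarrow> (x, y) \<in> parcs H)"
    if "pair_graph H" "(\<Union>u\<in>pverts G. L u) = pverts H" "u \<in> pverts G" for u
    using that by (intro complete_induced_iff) auto
  have 2: "matching (edges_between H (L u) (L v)) \<longleftrightarrow>
     (\<forall>x\<in>L u. \<forall>y\<in>L v. \<forall>x'\<in>L u. \<forall>y'\<in>L v. (x, y) \<in> parcs H \<longrightarrow> (x', y') \<in> parcs H \<longrightarrow>
        (x = x' \<longleftrightarrow> y = y'))"
    if "disjoint_family_on L (pverts G)" "(u, v) \<in> parcs G" for u v
    using that G[OF that(2)] by (intro matching_edges_between_iff) (auto simp: disjoint_family_on_def)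
  have 3: "edges_between H (L u) (L v) \<noteq> {} \<longleftrightarrow> (\<exists>x\<in>L u. \<exists>y\<in>L v. (x, y) \<in> parcs H)" for u v
    by (auto simp: edges_between_def)
  show ?thesis
  proof (cases "pair_graph H \<and> disjoint_family_on L (pverts G) \<and> (\<Union>u\<in>pverts G. L u) = pverts H")
    case True
    then have c: "pair_graph H" "disjoint_family_on L (pverts G)" "(\<Union>u\<in>pverts G. L u) = pverts H"
      by auto
    have c1: "(\<forall>u\<in>pverts G. complete_digraph (card (L u)) (with_proj H \<restriction> L u)) \<longleftrightarrow>
        (\<forall>u\<in>pverts G. \<forall>x\<in>L u. \<forall>y\<in>L u. x \<noteq> y \<longrightarrow> (x, y) \<in> parcs H)"
      using 1[OF c(1,3)] by (rule ball_cong[OF refl])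
    have c2: "(\<forall>(u, v)\<in>parcs G. matching (edges_between H (L u) (L v))) \<longleftrightarrow>
        (\<forall>u v. (u, v) \<in> parcs G \<longrightarrow> (\<forall>x\<in>L u. \<forall>y\<in>L v. \<forall>x'\<in>L u. \<forall>y'\<in>L v.
        (x, y) \<in> parcs H \<longrightarrow> (x', y') \<in> parcs H \<longrightarrow> (x = x' \<longleftrightarrow> y = y')))"
      using 2[OF c(2)] by fastforce
    have c3: "(\<forall>u\<in>pverts G. \<forall>v\<in>pverts G.
          edges_between H (L u) (L v) \<noteq> {} \<longrightarrow> u = v \<or> (u, v) \<in> parcs G) \<longleftrightarrow>
        (\<forall>u\<in>pverts G. \<forall>v\<in>pverts G. \<forall>x\<in>L u. \<forall>y\<in>L v.
          (x, y) \<in> parcs H \<longrightarrow> u = v \<or> (u, v) \<in> parcs G)"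
      unfolding 3 by blast
    show ?thesis unfolding dp_cover_def c1 c2 c3 by (simp only: conj_assoc)
  next
    case False
    then show ?thesis unfolding dp_cover_def by blast
  qed
qed

lemma fold_cover_relabel:
  assumes G: "pair_graph G" and cov: "fold_cover k G L H"
    and f: "inj_on f (pverts G)" and g: "inj_on g (pverts H)"
  shows "fold_cover k (relabel f G) (\<lambda>v. g ` L (inv_into (pverts G) f v)) (relabel g H)"
proof -
  let ?i = "inv_into (pverts G) f"
  let ?L = "\<lambda>v. g ` L (?i v)"
  have inv: "?i (f u) = u" if "u \<in> pverts G" for u using f that by simp
  have G': "pair_graph (relabel f G)" using G f by (rule pair_graph_relabel)
  from cov have c: "dp_cover G L H" and k: "\<And>u. u \<in> pverts G \<Longrightarrow> card (L u) = k"
    by (auto simp: fold_cover_def)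
  from c have H: "pair_graph H"
    and c1: "disjoint_family_on L (pverts G)" and c2: "(\<Union>u\<in>pverts G. L u) = pverts H"
    and c3: "\<And>u x y. \<lbrakk>u \<in> pverts G; x \<in> L u; y \<in> L u; x \<noteq> y\<rbrakk> \<Longrightarrow> (x, y) \<in> parcs H"
    and c4: "\<And>u v x y. \<lbrakk>u \<in> pverts G; v \<in> pverts G; x \<in> L u; y \<in> L v; (x, y) \<in> parcs H\<rbrakk>
      \<Longrightarrow> u = v \<or> (u, v) \<in> parcs G"
    and c5: "\<And>u v x y x' y'. \<lbrakk>(u, v) \<in> parcs G; x \<in> L u; y \<in> L v; x' \<in> L u; y' \<in> L v;
      (x, y) \<in> parcs H; (x', y') \<in> parcs H\<rbrakk> \<Longrightarrow> x = x' \<longleftrightarrow> y = y'"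
    unfolding dp_cover_iff[OF G] by simp_all (elim conjE, blast)
  have Lsub: "L u \<subseteq> pverts H" if "u \<in> pverts G" for u using c2 that by blast
  have Gin: "u \<in> pverts G \<and> v \<in> pverts G" if "(u, v) \<in> parcs G" for u v
    using G that by (auto simp: pair_graph_iff)
  have arcH: "(g x, g y) \<in> parcs (relabel g H) \<longleftrightarrow> (x, y) \<in> parcs H"
    if "x \<in> L u" "u \<in> pverts G" "y \<in> L v" "v \<in> pverts G" for x y u v
    using that Lsub by (intro parcs_relabel_iff[OF H g]) auto
  have arcG: "(f u, f v) \<in> parcs (relabel f G) \<longleftrightarrow> (u, v) \<in> parcs G"
    if "u \<in> pverts G" "v \<in> pverts G" for u v
    using that by (intro parcs_relabel_iff[OF G f]) auto
  have geq: "g x = g y \<longleftrightarrow> x = y"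
    if "x \<in> L u" "u \<in> pverts G" "y \<in> L v" "v \<in> pverts G" for x y u v
    using that Lsub g by (meson inj_on_eq_iff subsetD)
  have "dp_cover (relabel f G) ?L (relabel g H)"
    unfolding dp_cover_iff[OF G']
  proof (intro conjI)
    show "pair_graph (relabel g H)" using H g by (rule pair_graph_relabel)
    show "disjoint_family_on ?L (pverts (relabel f G))"
      unfolding disjoint_family_on_def
    proof (intro ballI impI)
      fix a b assume "a \<in> pverts (relabel f G)" "b \<in> pverts (relabel f G)" "a \<noteq> b"
      then obtain u v where uv: "u \<in> pverts G" "v \<in> pverts G" "a = f u" "b = f v" "u \<noteq> v" by auto
      then have "L u \<inter> L v = {}" using c1 unfolding disjoint_family_on_def by blast
      then have "g ` L u \<inter> g ` L v = {}"
        using inj_on_image_Int[OF g Lsub Lsub] uv by (metis image_empty)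
      then show "?L a \<inter> ?L b = {}" using uv inv by simp
    qed
    show "(\<Union>u\<in>pverts (relabel f G). ?L u) = pverts (relabel g H)"
      using inv by (simp add: c2[symmetric] image_UN)
    show "\<forall>u\<in>pverts (relabel f G). \<forall>x\<in>?L u. \<forall>y\<in>?L u. x \<noteq> y \<longrightarrow> (x, y) \<in> parcs (relabel g H)"
    proof (intro ballI impI)
      fix a p q assume *: "a \<in> pverts (relabel f G)" "p \<in> ?L a" "q \<in> ?L a" "p \<noteq> q"
      then obtain u where u: "u \<in> pverts G" "a = f u" by auto
      with * inv obtain x y where xy: "x \<in> L u" "y \<in> L u" "p = g x" "q = g y" by auto
      have "(x, y) \<in> parcs H" using c3[OF u(1) xy(1,2)] xy * by blast
      then show "(p, q) \<in> parcs (relabel g H)" using arcH xy u by blast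
    qed
    show "\<forall>u\<in>pverts (relabel f G). \<forall>v\<in>pverts (relabel f G). \<forall>x\<in>?L u. \<forall>y\<in>?L v.
        (x, y) \<in> parcs (relabel g H) \<longrightarrow> u = v \<or> (u, v) \<in> parcs (relabel f G)"
    proof (intro ballI impI)
      fix a b p q assume *: "a \<in> pverts (relabel f G)" "b \<in> pverts (relabel f G)"
        "p \<in> ?L a" "q \<in> ?L b" "(p, q) \<in> parcs (relabel g H)"
      then obtain u v where u: "u \<in> pverts G" "a = f u" "v \<in> pverts G" "b = f v" by auto
      with * inv obtain x y where xy: "x \<in> L u" "y \<in> L v" "p = g x" "q = g y" by auto
      have "(x, y) \<in> parcs H" using arcH[OF xy(1) u(1) xy(2) u(3)] xy * by simp
      then have "u = v \<or> (u, v) \<in> parcs G" using c4[OF u(1,3) xy(1,2)] by blast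
      then show "a = b \<or> (a, b) \<in> parcs (relabel f G)" using arcG u by blast
    qed
    show "\<forall>u v. (u, v) \<in> parcs (relabel f G) \<longrightarrow> (\<forall>x\<in>?L u. \<forall>y\<in>?L v. \<forall>x'\<in>?L u. \<forall>y'\<in>?L v.
        (x, y) \<in> parcs (relabel g H) \<longrightarrow> (x', y') \<in> parcs (relabel g H) \<longrightarrow> (x = x' \<longleftrightarrow> y = y'))"
    proof (intro allI ballI impI)
      fix a b p q p' q' assume *: "(a, b) \<in> parcs (relabel f G)"
        "p \<in> ?L a" "q \<in> ?L b" "p' \<in> ?L a" "q' \<in> ?L b"
        "(p, q) \<in> parcs (relabel g H)" "(p', q') \<in> parcs (relabel g H)"
      then obtain u v where u: "(u, v) \<in> parcs G" "a = f u" "b = f v" by auto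
      then have uv: "u \<in> pverts G" "v \<in> pverts G" using Gin by auto
      from * inv u uv obtain x y x' y' where xy: "x \<in> L u" "y \<in> L v" "p = g x" "q = g y"
        "x' \<in> L u" "y' \<in> L v" "p' = g x'" "q' = g y'" by auto
      have "(x, y) \<in> parcs H" "(x', y') \<in> parcs H"
        using arcH[OF xy(1) uv(1) xy(2) uv(2)] arcH[OF xy(5) uv(1) xy(6) uv(2)] xy * by simp_all
      then have "x = x' \<longleftrightarrow> y = y'" using c5[OF u(1) xy(1,2,5,6)] by blast
      then show "p = p' \<longleftrightarrow> q = q'"
        using geq[OF xy(1) uv(1) xy(5) uv(1)] geq[OF xy(2) uv(2) xy(6) uv(2)] xy by simp
    qed
  qed
  moreover have "card (?L a) = k" if "a \<in> pverts (relabel f G)" for a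
  proof -
    from that obtain u where u: "u \<in> pverts G" "a = f u" by auto
    then have "card (g ` L u) = card (L u)"
      using card_image[OF inj_on_subset[OF g Lsub]] by blast
    then show ?thesis using u inv k by simp
  qed
  ultimately show ?thesis by (simp add: fold_cover_def)
qed

lemma dp_coloring_relabel:
  assumes "pair_graph G" "pair_graph H" "inj_on f (pverts G)" "inj_on g (pverts H)"
    and col: "dp_coloring (relabel f G) (relabel g H) I"
  shows "\<exists>J. dp_coloring G H J"
proof -
  let ?J = "{x \<in> pverts H. g x \<in> I}"
  have I: "I \<subseteq> g ` pverts H" "\<forall>x\<in>I. \<forall>y\<in>I. (x, y) \<notin> parcs (relabel g H)"
      "card I = card (f ` pverts G)"
    using col by (auto simp: dp_coloring_def independent_set_def)
  have "g ` ?J = I" using I(1) by auto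
  moreover have "inj_on g ?J" using assms(4) by (auto simp: inj_on_def)
  ultimately have "card ?J = card I" by (metis card_image)
  also have "\<dots> = card (pverts G)" using I(3) assms(3) by (simp add: card_image)
  finally have "card ?J = card (pverts G)" .
  moreover have "independent_set H ?J"
    using I(2) parcs_relabel_iff[OF assms(2,4)] by (auto simp: independent_set_def)
  ultimately show ?thesis unfolding dp_coloring_def by blast
qed

lemma fold_cover_colorable_relabel:
  fixes G :: "'a pair_pre_digraph" and L :: "'a \<Rightarrow> 'b set" and f :: "'a \<Rightarrow> 'c"
  assumes G: "pair_graph G" and f: "inj_on f (pverts G)"
    and k: "\<forall>(L :: 'c \<Rightarrow> nat set) H. fold_cover k (relabel f G) L H \<longrightarrow>
              (\<exists>I. dp_coloring (relabel f G) H I)"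
    and cov: "fold_cover k G L H"
  shows "\<exists>I. dp_coloring G H I"
proof -
  have H: "pair_graph H" using cov by (simp add: fold_cover_def dp_cover_def)
  then have "finite (pverts H)" by (simp add: pair_graph_iff)
  from finite_imp_inj_to_nat_seg[OF this]
  obtain g :: "'b \<Rightarrow> nat" where g: "inj_on g (pverts H)" by (elim exE conjE)
  obtain I where "dp_coloring (relabel f G) (relabel g H) I"
    using k[rule_format, OF fold_cover_relabel[OF G cov f g]] by (elim exE)
  with G H f g show ?thesis by (rule dp_coloring_relabel)
qed

lemma relabel_cong_id: "\<lbrakk>pair_graph G; \<And>x. x \<in> pverts G \<Longrightarrow> f x = x\<rbrakk> \<Longrightarrow> relabel f G = G"
proof -
  assume G: "pair_graph G" and f: "\<And>x. x \<in> pverts G \<Longrightarrow> f x = x"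
  have "map_prod f f e = e" if "e \<in> parcs G" for e
    using that G f by (cases e) (auto simp: pair_graph_iff)
  then have "map_prod f f ` parcs G = parcs G" by force
  moreover have "f ` pverts G = pverts G" using f by force
  ultimately show ?thesis by (simp add: relabel_def)
qed

lemma relabel_relabel: "relabel f (relabel g G) = relabel (f \<circ> g) G"
  by (simp add: relabel_def image_comp map_prod.comp)

theorem dp_chromatic_number_relabel:
  fixes f :: "'a \<Rightarrow> 'b"
  assumes G: "pair_graph G" and f: "inj_on f (pverts G)"
  shows "dp_chromatic_number (relabel f G) = dp_chromatic_number G"
proof -
  let ?i = "inv_into (pverts G) f"
  have G': "pair_graph (relabel f G)" using G f by (rule pair_graph_relabel)
  have i: "inj_on ?i (pverts (relabel f G))" by (simp add: inj_on_inv_into)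
  have inv: "relabel ?i (relabel f G) = G"
    unfolding relabel_relabel using f by (intro relabel_cong_id[OF G]) simp
  have "(\<forall>(L :: 'b \<Rightarrow> nat set) H. fold_cover k (relabel f G) L H \<longrightarrow> (\<exists>I. dp_coloring (relabel f G) H I))
    \<longleftrightarrow> (\<forall>(L :: 'a \<Rightarrow> nat set) H. fold_cover k G L H \<longrightarrow> (\<exists>I. dp_coloring G H I))" for k
    by (intro iffI allI impI;
        erule (1) fold_cover_colorable_relabel[OF G f] fold_cover_colorable_relabel[OF G' i, unfolded inv])
  then show ?thesis unfolding dp_chromatic_number_def by simp
qed

text \<open>Greedy coloring: some \<open>k\<close> as in \<open>dp_chromatic_number\<close> always exists.\<close>

lemma fold_cover_greedy:
  assumes G: "pair_graph G" and cov: "fold_cover (card (pverts G)) G L H"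
  shows "\<exists>I. dp_coloring G H I"
proof -
  from cov have c: "dp_cover G L H" and k: "\<And>u. u \<in> pverts G \<Longrightarrow> card (L u) = card (pverts G)"
    by (auto simp: fold_cover_def)
  from c have H: "pair_graph H"
    and c1: "disjoint_family_on L (pverts G)" and c2: "(\<Union>u\<in>pverts G. L u) = pverts H"
    and c3: "\<And>u x y. \<lbrakk>u \<in> pverts G; x \<in> L u; y \<in> L u; x \<noteq> y\<rbrakk> \<Longrightarrow> (x, y) \<in> parcs H"
    and c4: "\<And>u v x y. \<lbrakk>u \<in> pverts G; v \<in> pverts G; x \<in> L u; y \<in> L v; (x, y) \<in> parcs H\<rbrakk>
      \<Longrightarrow> u = v \<or> (u, v) \<in> parcs G"
    and c5: "\<And>u v x y x' y'. \<lbrakk>(u, v) \<in> parcs G; x \<in> L u; y \<in> L v; x' \<in> L u; y' \<in> L v;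
      (x, y) \<in> parcs H; (x', y') \<in> parcs H\<rbrakk> \<Longrightarrow> x = x' \<longleftrightarrow> y = y'"
    unfolding dp_cover_iff[OF G] by simp_all (elim conjE, blast)
  have fin: "finite (pverts G)" using G by (simp add: pair_graph_iff)
  have "\<exists>\<phi>. \<forall>u\<in>U. \<phi> u \<in> L u \<and> (\<forall>v\<in>U. (\<phi> u, \<phi> v) \<notin> parcs H)"
    if "finite U" "U \<subseteq> pverts G" for U
    using that
  proof (induction U rule: finite_induct)
    case empty
    then show ?case by simp
  next
    case (insert w U)
    then obtain \<phi> where \<phi>: "\<And>u. u \<in> U \<Longrightarrow> \<phi> u \<in> L u"
        "\<And>u v. u \<in> U \<Longrightarrow> v \<in> U \<Longrightarrow> (\<phi> u, \<phi> v) \<notin> parcs H" by auto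
    let ?B = "\<Union>u\<in>U. {y \<in> L w. (\<phi> u, y) \<in> parcs H}"
    have w: "w \<in> pverts G" using insert.prems by simp
    have finw: "finite (L w)"
    proof (rule finite_subset)
      show "L w \<subseteq> pverts H" using c2 w by blast
      show "finite (pverts H)" using H by (simp add: pair_graph_iff)
    qed
    have one: "card {y \<in> L w. (\<phi> u, y) \<in> parcs H} \<le> 1" if u: "u \<in> U" for u
    proof -
      have "y = y'" if y: "y \<in> L w" "(\<phi> u, y) \<in> parcs H" "y' \<in> L w" "(\<phi> u, y') \<in> parcs H" for y y'
      proof -
        have "u \<in> pverts G" "u \<noteq> w" using u insert by auto
        then have "(u, w) \<in> parcs G" using c4[OF _ w \<phi>(1)[OF u] y(1,2)] by blast
        then show ?thesis using c5[OF _ \<phi>(1)[OF u] y(1) \<phi>(1)[OF u] y(3) y(2,4)] by blast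
      qed
      then show ?thesis using finw by (auto simp: card_le_Suc0_iff_eq)
    qed
    have "card ?B \<le> (\<Sum>u\<in>U. card {y \<in> L w. (\<phi> u, y) \<in> parcs H})"
      using insert.hyps by (intro card_UN_le)
    also have "\<dots> \<le> (\<Sum>u\<in>U. 1)" by (rule sum_mono) (rule one)
    also have "\<dots> < card (insert w U)" using insert.hyps by simp
    also have "\<dots> \<le> card (L w)" using k[OF w] card_mono[OF fin insert.prems] by simp
    finally have "card ?B < card (L w)" .
    moreover have "finite ?B" using finw by (rule finite_subset[rotated]) auto
    ultimately have "\<not> L w \<subseteq> ?B" using card_mono by fastforce
    then obtain y where y: "y \<in> L w" "\<And>u. u \<in> U \<Longrightarrow> (\<phi> u, y) \<notin> parcs H" by auto
    then have "(y, \<phi> u) \<notin> parcs H" if "u \<in> U" for u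
      using that H unfolding pair_graph_iff by blast
    moreover have "(y, y) \<notin> parcs H" using H unfolding pair_graph_iff by blast
    ultimately show ?case
      using insert.hyps \<phi> y by (intro exI[of _ "\<phi>(w := y)"]) auto
  qed
  from this[OF fin order_refl] obtain \<phi> where
    \<phi>: "\<And>u. u \<in> pverts G \<Longrightarrow> \<phi> u \<in> L u"
       "\<And>u v. u \<in> pverts G \<Longrightarrow> v \<in> pverts G \<Longrightarrow> (\<phi> u, \<phi> v) \<notin> parcs H" by blast
  have "inj_on \<phi> (pverts G)"
  proof (rule inj_onI, rule ccontr)
    fix u v assume *: "u \<in> pverts G" "v \<in> pverts G" "\<phi> u = \<phi> v" "u \<noteq> v"
    then have "L u \<inter> L v = {}" using c1 unfolding disjoint_family_on_def by blast
    then show False using \<phi>(1)[of u] \<phi>(1)[of v] * by auto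
  qed
  then have "card (\<phi> ` pverts G) = card (pverts G)" by (rule card_image)
  moreover have "independent_set H (\<phi> ` pverts G)"
    using \<phi> c2 unfolding independent_set_def by blast
  ultimately show ?thesis unfolding dp_coloring_def by blast
qed

theorem fold_cover_colorable:
  fixes G :: "'a pair_pre_digraph" and L :: "'a \<Rightarrow> 'b set"
  assumes G: "pair_graph G" and cov: "fold_cover (dp_chromatic_number G) G L H"
  shows "\<exists>I. dp_coloring G H I"
proof -
  let ?P = "\<lambda>k. \<forall>(L :: 'a \<Rightarrow> nat set) H. fold_cover k G L H \<longrightarrow> (\<exists>I. dp_coloring G H I)"
  have id: "relabel id G = G" using G by (rule relabel_cong_id) simp
  have "?P (card (pverts G))" using fold_cover_greedy[OF G] by blast
  then have "?P (dp_chromatic_number G)" unfolding dp_chromatic_number_def by (rule LeastI)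
  then show ?thesis
    using fold_cover_colorable_relabel[OF G, of id] cov unfolding id by auto
qed

end

theory Submission
  imports Defs "HOL-Library.FuncSet"
begin

text \<open>
  A uniformly random partial coloring is a uniformly random independent set \<open>I\<close> of \<open>H\<close>. The
  neighbors in other lists of a color \<open>x\<close> of \<open>v\<close> span a graph without \<open>r\<close>-cliques, and given
  the rest of \<open>I\<close> the trace of \<open>I\<close> on them is a uniform independent set of a subgraph \<open>F\<close>. By
  a Ramsey bound, either \<open>F\<close> has at most \<open>\<surd>\<Delta>\<close> independent sets, and \<open>x\<close> stays available with
  probability at least \<open>1/\<surd>\<Delta>\<close>, or at least half of its independent sets have order
  \<open>ln \<Delta> / (r ln ln \<Delta>)\<close> elements. The traces for different \<open>x\<close> are disjoint and have at most
  \<open>\<Delta>\<close> elements in total, so the second case is exceptional and, with overwhelming probability,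
  \<open>v\<close> keeps many available colors. Likewise an available \<open>x\<close> is very unlikely to have many
  neighbors that are still available. A lopsided local lemma gives a partial coloring with both
  properties everywhere, and it is completed by counting colorings: adding a vertex
  multiplies the number of colorings by at least half of the list size.
\<close>

section \<open>Independent sets in graphs without large cliques\<close>

definition indep :: "('b \<Rightarrow> 'b \<Rightarrow> bool) \<Rightarrow> 'b set \<Rightarrow> 'b set set" where
  "indep A X = {I. I \<subseteq> X \<and> (\<forall>x\<in>I. \<forall>y\<in>I. \<not> A x y)}"

definition clique_free :: "('b \<Rightarrow> 'b \<Rightarrow> bool) \<Rightarrow> nat \<Rightarrow> 'b set \<Rightarrow> bool" where
  "clique_free A r X \<longleftrightarrow>
     (\<forall>Q. Q \<subseteq> X \<longrightarrow> finite Q \<longrightarrow> card Q = r \<longrightarrow> (\<exists>x\<in>Q. \<exists>y\<in>Q. x \<noteq> y \<and> \<not> A x y))"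

section \<open>Ramsey bounds and counts of independent sets\<close>

lemma clique_freeD:
  "\<lbrakk>clique_free A r X; Q \<subseteq> X; finite Q; card Q = r\<rbrakk> \<Longrightarrow> \<exists>x\<in>Q. \<exists>y\<in>Q. x \<noteq> y \<and> \<not> A x y"
  unfolding clique_free_def by simp

lemma indepD: "I \<in> indep A X \<Longrightarrow> I \<subseteq> X" "I \<in> indep A X \<Longrightarrow> x \<in> I \<Longrightarrow> y \<in> I \<Longrightarrow> \<not> A x y"
  by (auto simp: indep_def)

lemma finite_indep [simp]: "finite X \<Longrightarrow> finite (indep A X)"
  by (rule finite_subset[of _ "Pow X"]) (auto simp: indep_def)

lemma empty_in_indep [simp]: "{} \<in> indep A X"
  by (auto simp: indep_def)

lemma card_indep_pos: "finite X \<Longrightarrow> card (indep A X) > 0"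
  using empty_in_indep[of A X] finite_indep[of X A] by (metis card_gt_0_iff empty_iff)

lemma clique_free_mono: "clique_free A r X \<Longrightarrow> Y \<subseteq> X \<Longrightarrow> clique_free A r Y"
  unfolding clique_free_def using subset_trans[of _ Y X] by simp

text \<open>Greedy choice: a chosen vertex and its neighbors use up at most \<open>d\<close>
  vertices, so \<open>b\<close> rounds fit into \<open>b * d\<close> vertices.\<close>

lemma indep_of_bounded_degree:
  assumes "finite X" "\<And>x y. A x y \<Longrightarrow> A y x" "\<And>x. \<not> A x x"
    and "\<And>x. x \<in> X \<Longrightarrow> card {y \<in> X. A x y} < d" "b * d \<le> card X" "0 < d"
  shows "\<exists>I\<in>indep A X. card I = b"
  using assms(1,4,5)
proof (induction b arbitrary: X)
  case 0
  then show ?case by (intro bexI[of _ "{}"]) auto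
next
  case (Suc b)
  show ?case
  proof (cases "X = {}")
    case True
    with Suc.prems assms(6) show ?thesis by simp
  next
    case False
    then obtain x where x: "x \<in> X" by blast
    let ?N = "insert x {y \<in> X. A x y}"
    have N: "card ?N \<le> d" using Suc.prems(2)[OF x] Suc.prems(1) by (simp add: card_insert_if)
    have sub: "?N \<subseteq> X" using x by auto
    have "card (X - ?N) = card X - card ?N"
      using sub Suc.prems(1) by (meson card_Diff_subset finite_subset)
    then have b: "b * d \<le> card (X - ?N)" using N Suc.prems(3) by simp
    have deg: "card {y \<in> X - ?N. A z y} < d" if "z \<in> X - ?N" for z
    proof -
      have "card {y \<in> X - ?N. A z y} \<le> card {y \<in> X. A z y}"
        using Suc.prems(1) by (intro card_mono) auto
      then show ?thesis using Suc.prems(2)[of z] that by auto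
    qed
    obtain I where I: "I \<in> indep A (X - ?N)" "card I = b"
      using Suc.IH[OF _ deg b] Suc.prems(1) by blast
    have fI: "finite I" using indepD(1)[OF I(1)] Suc.prems(1) by (meson finite_Diff finite_subset)
    have "x \<notin> I" using indepD(1)[OF I(1)] by auto
    moreover have "\<not> A u v" if "u \<in> insert x I" "v \<in> insert x I" for u v
      using that indepD[OF I(1)] assms(2)[of u v] assms(3)[of x] by blast
    then have "insert x I \<in> indep A X"
      using x indepD(1)[OF I(1)] unfolding indep_def by blast
    ultimately show ?thesis using I(2) fI by (intro bexI[of _ "insert x I"]) auto
  qed
qed

text \<open>Induction on \<open>r\<close>: either some \<open>x\<close> has \<open>b ^ r\<close>
  neighbors, among which there is no clique of size \<open>r\<close> because \<open>x\<close> would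
  extend it, or all degrees are below \<open>b ^ r\<close> and the greedy choice finds
  \<open>b\<close> vertices.\<close>

lemma ramsey_power:
  assumes "finite X" "\<And>x y. A x y \<Longrightarrow> A y x" "\<And>x. \<not> A x x"
    and "clique_free A r X" "b ^ r \<le> card X"
  shows "\<exists>I\<in>indep A X. card I = b"
  using assms(1,4,5)
proof (induction r arbitrary: X)
  case 0
  \<comment> \<open>The empty set is a clique of size \<open>0\<close>, so the hypothesis is
    contradictory.\<close>
  then show ?case unfolding clique_free_def by (auto dest: spec[of _ "{}"])
next
  case (Suc r)
  show ?case
  proof (cases "\<exists>x\<in>X. b ^ r \<le> card {y \<in> X. A x y}")
    case True
    then obtain x where x: "x \<in> X" "b ^ r \<le> card {y \<in> X. A x y}" by blast
    have "clique_free A r {y \<in> X. A x y}"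
      unfolding clique_free_def
    proof (intro allI impI)
      fix Q assume Q: "Q \<subseteq> {y \<in> X. A x y}" "finite Q" "card Q = r"
      then have "x \<notin> Q" using assms(3) by blast
      then have "insert x Q \<subseteq> X" "card (insert x Q) = Suc r" "finite (insert x Q)"
        using Q x by auto
      then obtain u v where "u \<in> insert x Q" "v \<in> insert x Q" "u \<noteq> v" "\<not> A u v"
        using Suc.prems(2) unfolding clique_free_def by meson
      moreover from this have "\<not> A v u" using assms(2) by meson
      ultimately show "\<exists>x\<in>Q. \<exists>y\<in>Q. x \<noteq> y \<and> \<not> A x y" using Q(1) by blast
    qed
    from Suc.IH[OF _ this x(2)] Suc.prems(1) obtain I
      where "I \<in> indep A {y \<in> X. A x y}" "card I = b" by auto
    then show ?thesis by (intro bexI[of _ I]) (auto simp: indep_def)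
  next
    case False
    show ?thesis
    proof (cases "b = 0")
      case True
      then show ?thesis by (intro bexI[of _ "{}"]) auto
    next
      case b: False
      have "card {y \<in> X. A x y} < b ^ r" if "x \<in> X" for x
        using False that by (meson not_le)
      from indep_of_bounded_degree[OF Suc.prems(1) assms(2,3) this] b Suc.prems(3)
      show ?thesis by (simp add: mult.commute)
    qed
  qed
qed

lemma card_indep_ge_power:
  assumes "finite X" "\<And>x y. A x y \<Longrightarrow> A y x" "\<And>x. \<not> A x x"
    and "clique_free A r X" "b ^ r \<le> card X"
  shows "2 ^ b \<le> card (indep A X)"
proof -
  obtain I where I: "I \<in> indep A X" "card I = b"
    using ramsey_power[OF assms] by blast
  have "finite I" using indepD(1)[OF I(1)] assms(1) by (rule finite_subset)
  then have "2 ^ b = card (Pow I)" using I by (simp add: card_Pow)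
  also have "\<dots> \<le> card (indep A X)"
    using I assms(1) by (intro card_mono) (auto simp: indep_def)
  finally show ?thesis .
qed

text \<open>A set with at most \<open>a\<close> elements is given by \<open>a\<close> choices, each
  of an element of \<open>X\<close> or of nothing.\<close>

lemma card_small_subsets:
  assumes "finite X"
  shows "card {I. I \<subseteq> X \<and> card I \<le> a} \<le> (card X + 1) ^ a"
proof (induction a)
  case 0
  have "{I. I \<subseteq> X \<and> card I \<le> 0} = {{}}"
    using assms by (auto dest: finite_subset)
  then show ?case by simp
next
  case (Suc a)
  let ?S = "\<lambda>a. {I. I \<subseteq> X \<and> card I \<le> a}"
  let ?f = "\<lambda>(I, z). case z of None \<Rightarrow> I | Some y \<Rightarrow> insert y I"
  have fin: "finite (?S a)" using assms by simp
  have "?S (Suc a) \<subseteq> ?f ` (?S a \<times> insert None (Some ` X))"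
  proof
    fix I assume I: "I \<in> ?S (Suc a)"
    show "I \<in> ?f ` (?S a \<times> insert None (Some ` X))"
    proof (cases "I = {}")
      case True
      then show ?thesis by (intro image_eqI[of _ _ "({}, None)"]) auto
    next
      case False
      then obtain y where y: "y \<in> I" by blast
      have "finite I" using I assms by (auto dest: finite_subset)
      then have "card (I - {y}) \<le> a" using I y by (auto simp: card_Diff_singleton)
      then show ?thesis using I y by (intro image_eqI[of _ _ "(I - {y}, Some y)"]) auto
    qed
  qed
  then have "card (?S (Suc a)) \<le> card (?f ` (?S a \<times> insert None (Some ` X)))"
    using fin assms by (intro card_mono) auto
  also have "\<dots> \<le> card (?S a \<times> insert None (Some ` X))"
    using fin assms by (intro card_image_le) auto
  also have "\<dots> = card (?S a) * (card X + 1)"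
    using assms by (simp add: card_cartesian_product card_insert_if card_image)
  also have "\<dots> \<le> (card X + 1) ^ a * (card X + 1)"
    using Suc.IH by (rule mult_right_mono) simp
  finally show ?case by (simp add: mult.commute)
qed

text \<open>Given \<open>J = I - M\<close>, the trace \<open>I \<inter> M\<close> ranges over
  exactly the independent sets among the vertices of \<open>M\<close> without a neighbor in
  \<open>J\<close>. Hence that trace is uniform, which is the conditioning behind all later
  estimates.\<close>

lemma sum_indep_split:
  fixes h :: "'b set \<Rightarrow> 'c::comm_monoid_add"
  assumes "finite X" "M \<subseteq> X" and sym: "\<And>x y. A x y \<Longrightarrow> A y x"
  shows "(\<Sum>I\<in>indep A X. h I) =
    (\<Sum>J\<in>indep A (X - M). \<Sum>K\<in>indep A {y \<in> M. \<forall>z\<in>J. \<not> A y z}. h (J \<union> K))"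
proof -
  let ?F = "\<lambda>J. {y \<in> M. \<forall>z\<in>J. \<not> A y z}"
  have finM: "finite M" using assms(1,2) by (rule rev_finite_subset)
  have "(\<Sum>J\<in>indep A (X - M). \<Sum>K\<in>indep A (?F J). h (J \<union> K)) =
      (\<Sum>(J, K)\<in>Sigma (indep A (X - M)) (\<lambda>J. indep A (?F J)). h (J \<union> K))"
    using assms(1) finM by (intro sum.Sigma) auto
  also have "\<dots> = (\<Sum>I\<in>indep A X. h I)"
  proof (rule sum.reindex_bij_witness[of _ "\<lambda>I. (I - M, I \<inter> M)" "\<lambda>(J, K). J \<union> K"])
    fix p assume "p \<in> Sigma (indep A (X - M)) (\<lambda>J. indep A (?F J))"
    then obtain J K where p: "p = (J, K)" "J \<in> indep A (X - M)" "K \<in> indep A (?F J)" by auto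
    have "J \<subseteq> X - M" "K \<subseteq> M" using p(2,3) by (auto simp: indep_def)
    then show "((case p of (J, K) \<Rightarrow> J \<union> K) - M, (case p of (J, K) \<Rightarrow> J \<union> K) \<inter> M) = p"
      using p(1) by auto
    have "\<not> A x y" if "x \<in> J \<union> K" "y \<in> J \<union> K" for x y
      using that indepD[OF p(2)] indepD[OF p(3)] sym[of x y] by blast
    then show "(case p of (J, K) \<Rightarrow> J \<union> K) \<in> indep A X"
      using p(1) \<open>J \<subseteq> X - M\<close> \<open>K \<subseteq> M\<close> assms(2) unfolding indep_def by auto
    show "h (case p of (J, K) \<Rightarrow> J \<union> K) = (case p of (J, K) \<Rightarrow> h (J \<union> K))"
      using p(1) by simp
  next
    fix I assume I: "I \<in> indep A X"
    then show "(I - M, I \<inter> M) \<in> Sigma (indep A (X - M)) (\<lambda>J. indep A (?F J))"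
      by (auto simp: indep_def)
    show "(case (I - M, I \<inter> M) of (J, K) \<Rightarrow> J \<union> K) = I" by auto
  qed
  finally show ?thesis by simp
qed

lemma card_indep_split:
  assumes "finite X" "M \<subseteq> X" and sym: "\<And>x y. A x y \<Longrightarrow> A y x"
  shows "card (indep A X) =
    (\<Sum>J\<in>indep A (X - M). card (indep A {y \<in> M. \<forall>z\<in>J. \<not> A y z}))"
  using sum_indep_split[OF assms, where h = "\<lambda>_. 1::nat"] by simp

lemma card_Collect_indep_split:
  assumes "finite X" "M \<subseteq> X" and sym: "\<And>x y. A x y \<Longrightarrow> A y x"
  shows "card {I \<in> indep A X. P I} =
    (\<Sum>J\<in>indep A (X - M). card {K \<in> indep A {y \<in> M. \<forall>z\<in>J. \<not> A y z}. P (J \<union> K)})"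
proof -
  have c: "(\<Sum>x\<in>S. if Q x then 1::nat else 0) = card {x \<in> S. Q x}"
    if "finite S" for S :: "'a set set" and Q
    using that by (simp add: sum.inter_filter[symmetric])
  have fM: "finite M" using assms(1,2) by (rule rev_finite_subset)
  have "card {I \<in> indep A X. P I} = (\<Sum>I\<in>indep A X. if P I then 1::nat else 0)"
    using assms(1) by (intro c[symmetric]) auto
  also have "\<dots> = (\<Sum>J\<in>indep A (X - M). \<Sum>K\<in>indep A {y \<in> M. \<forall>z\<in>J. \<not> A y z}.
      if P (J \<union> K) then 1 else 0)"
    by (rule sum_indep_split[OF assms])
  also have "\<dots> = (\<Sum>J\<in>indep A (X - M). card {K \<in> indep A {y \<in> M. \<forall>z\<in>J. \<not> A y z}. P (J \<union> K)})"
    using fM by (intro sum.cong refl c) auto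
  finally show ?thesis .
qed

text \<open>The sets \<open>M x\<close> are split off one at a time. As they are disjoint, the other
  factors stay constant while the trace on \<open>M t\<close> varies, and the bound
  \<open>q\<close>, assumed for every possible remainder \<open>F\<close> of \<open>M t\<close>,
  applies conditionally.\<close>

lemma sum_indep_prod_le:
  fixes g :: "nat \<Rightarrow> real" and q :: real
  assumes "finite X" and sym: "\<And>x y. A x y \<Longrightarrow> A y x"
    and "finite T" "\<And>x. x \<in> T \<Longrightarrow> M x \<subseteq> X"
    and "\<And>x y. x \<in> T \<Longrightarrow> y \<in> T \<Longrightarrow> x \<noteq> y \<Longrightarrow> M x \<inter> M y = {}"
    and g: "\<And>n. g n \<ge> 0" and "q \<ge> 0"
    and q: "\<And>x F. x \<in> T \<Longrightarrow> F \<subseteq> M x \<Longrightarrow> (\<Sum>K\<in>indep A F. g (card K)) \<le> q * card (indep A F)"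
  shows "(\<Sum>I\<in>indep A X. \<Prod>x\<in>T. g (card (I \<inter> M x))) \<le> q ^ card T * card (indep A X)"
  using assms(3,4,5) q
proof (induction T rule: finite_induct)
  case empty
  then show ?case by simp
next
  case (insert t T)
  let ?F = "\<lambda>J. {y \<in> M t. \<forall>z\<in>J. \<not> A y z}"
  let ?P = "\<lambda>I. \<Prod>x\<in>T. g (card (I \<inter> M x))"
  have Mt: "M t \<subseteq> X" using insert.prems(1) by simp
  have P: "?P (J \<union> K) = ?P J" if "K \<subseteq> M t" for J K
  proof (rule prod.cong[OF refl])
    fix x assume "x \<in> T"
    then have "M x \<inter> M t = {}" using insert by blast
    then have "(J \<union> K) \<inter> M x = J \<inter> M x" using that by blast
    then show "g (card ((J \<union> K) \<inter> M x)) = g (card (J \<inter> M x))" by simp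
  qed
  have "(\<Sum>I\<in>indep A X. \<Prod>x\<in>insert t T. g (card (I \<inter> M x))) =
      (\<Sum>I\<in>indep A X. g (card (I \<inter> M t)) * ?P I)"
    using insert.hyps by simp
  also have "\<dots> = (\<Sum>J\<in>indep A (X - M t). \<Sum>K\<in>indep A (?F J).
      g (card ((J \<union> K) \<inter> M t)) * ?P (J \<union> K))"
    by (rule sum_indep_split[OF assms(1) Mt sym])
  also have "\<dots> = (\<Sum>J\<in>indep A (X - M t). ?P J * (\<Sum>K\<in>indep A (?F J). g (card K)))"
    unfolding sum_distrib_left
  proof (intro sum.cong refl)
    fix J K assume J: "J \<in> indep A (X - M t)" and K: "K \<in> indep A (?F J)"
    have "(J \<union> K) \<inter> M t = K" using indepD(1)[OF J] indepD(1)[OF K] by blast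
    moreover have "?P (J \<union> K) = ?P J" using indepD(1)[OF K] by (intro P) blast
    ultimately show "g (card ((J \<union> K) \<inter> M t)) * ?P (J \<union> K) = ?P J * g (card K)" by simp
  qed
  also have "\<dots> \<le> (\<Sum>J\<in>indep A (X - M t). ?P J * (q * card (indep A (?F J))))"
    by (intro sum_mono mult_left_mono prod_nonneg insert.prems(3) ballI g) auto
  also have "\<dots> = q * (\<Sum>J\<in>indep A (X - M t). \<Sum>K\<in>indep A (?F J). ?P J)"
    by (simp add: sum_distrib_left mult_ac)
  also have "(\<Sum>J\<in>indep A (X - M t). \<Sum>K\<in>indep A (?F J). ?P J) =
      (\<Sum>J\<in>indep A (X - M t). \<Sum>K\<in>indep A (?F J). ?P (J \<union> K))"
    by (intro sum.cong refl P[symmetric]) (auto simp: indep_def)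
  also have "\<dots> = (\<Sum>I\<in>indep A X. ?P I)"
    by (rule sum_indep_split[OF assms(1) Mt sym, symmetric])
  also have "q * \<dots> \<le> q * (q ^ card T * card (indep A X))"
    by (intro mult_left_mono assms(7) insert.IH insert.prems) auto
  finally show ?case using insert.hyps by simp
qed

section \<open>Random independent sets\<close>

lemma nat_root_bounds:
  fixes n r :: nat
  assumes "r > 0"
  obtains b where "b ^ r \<le> n" "n < (b + 1) ^ r"
proof -
  define b where "b = (LEAST c. n < (c + 1) ^ r)"
  have "n < (n + 1) ^ r" using self_le_power[of "n + 1" r] assms by linarith
  then have "n < (b + 1) ^ r" unfolding b_def by (rule LeastI)
  moreover have "b ^ r \<le> n"
  proof (cases b)
    case 0
    then show ?thesis using assms by (simp add: zero_power)
  next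
    case (Suc c)
    then have "\<not> n < (c + 1) ^ r" unfolding b_def by (intro not_less_Least) simp
    then show ?thesis using Suc by simp
  qed
  ultimately show ?thesis by (rule that[rotated])
qed

lemma ln2_ge_half: "1 / 2 \<le> ln (2::real)"
  using ln_le_minus_one[of "1 / 2 :: real"] by (simp add: ln_div)

text \<open>Below, \<open>lam\<close> and \<open>mu\<close> stand for \<open>ln \<Delta>\<close> and \<open>ln ln \<Delta>\<close>.\<close>

lemma card_indep_dichotomy:
  fixes lam mu :: real
  assumes F: "finite F" "\<And>x y. A x y \<Longrightarrow> A y x" "\<And>x. \<not> A x x" "clique_free A r F"
    and r: "r > 0" and mu: "mu = ln lam" "mu \<ge> 1" and lam: "lam \<ge> 4"
    and ra: "real r * real a * mu \<le> lam / 8"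
  shows "real (card (indep A F)) \<le> exp (lam / 2) \<or>
    card (indep A F) \<le> 2 * card {I \<in> indep A F. a \<le> card I}"
proof (rule disjCI)
  \<comment> \<open>If the second alternative fails, most independent sets have fewer than
    \<open>a\<close> elements, so there are at most \<open>2 * (card F + 1) ^ a\<close> independent
    sets; by the Ramsey bound there are at least \<open>2 ^ b\<close>. Comparing the two forces
    \<open>b\<close> to be small, and then the count is small as well.\<close>
  assume "\<not> card (indep A F) \<le> 2 * card {I \<in> indep A F. a \<le> card I}"
  moreover have "card (indep A F) =
      card {I \<in> indep A F. a \<le> card I} + card {I \<in> indep A F. \<not> a \<le> card I}"
    using F(1) by (subst card_Un_disjoint[symmetric]) (auto intro: arg_cong[where f = card])
  moreover have "card {I \<in> indep A F. \<not> a \<le> card I} \<le> card {I. I \<subseteq> F \<and> card I \<le> a}"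
    using F(1) by (intro card_mono) (auto simp: indep_def)
  ultimately have N: "card (indep A F) \<le> 2 * (card F + 1) ^ a"
    using card_small_subsets[OF F(1), of a] by linarith
  obtain b where b: "b ^ r \<le> card F" "card F < (b + 1) ^ r" using nat_root_bounds[OF r] .
  define y where "y = real (b + 1)"
  have y: "y \<ge> 1" unfolding y_def by simp
  have "(card F + 1) ^ a \<le> ((b + 1) ^ r) ^ a" using b(2) by (intro power_mono) auto
  with N have "card (indep A F) \<le> 2 * (b + 1) ^ (r * a)" by (simp add: power_mult)
  then have "real (card (indep A F)) \<le> real (2 * (b + 1) ^ (r * a))" by (simp only: of_nat_le_iff)
  also have "\<dots> = 2 * y ^ (r * a)" unfolding y_def by simp
  also have "\<dots> = 2 * exp (real r * real a * ln y)"
    using y exp_of_nat_mult[of "r * a" "ln y"] by simp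
  finally have up: "real (card (indep A F)) \<le> 2 * exp (real r * real a * ln y)" .
  have "real (2 ^ b) \<le> real (card (indep A F))"
    using card_indep_ge_power[OF F b(1)] by (simp only: of_nat_le_iff)
  also note up
  finally have "ln (2 ^ b) \<le> ln (2 * exp (real r * real a * ln y))" by simp
  then have le: "(y - 1) * ln 2 \<le> ln 2 + real r * real a * ln y"
    by (simp add: ln_mult ln_realpow y_def)
  have "real r * real a \<le> real r * real a * mu"
    using mu(2) mult_left_mono[of 1 mu "real r * real a"] by simp
  with ra have ra': "real r * real a \<le> lam / 8" by linarith
  \<comment> \<open>For larger \<open>y\<close>, the estimate \<open>ln y \<le> 2 * sqrt y\<close>
    turns the upper bound into \<open>2 * exp (y / 4)\<close>, which is less than
    \<open>2 ^ b\<close> for \<open>y > 16\<close>.\<close>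
  have ylam: "y \<le> lam\<^sup>2"
  proof (rule ccontr)
    assume "\<not> y \<le> lam\<^sup>2"
    then have yl: "y > lam\<^sup>2" by simp
    then have sq: "lam < sqrt y" using lam real_less_rsqrt by blast
    have "ln y = 2 * ln (sqrt y)" using y by (simp add: ln_sqrt)
    also have "ln (sqrt y) \<le> sqrt y" using y ln_le_minus_one[of "sqrt y"] by simp
    finally have "ln y \<le> 2 * sqrt y" by simp
    then have "real r * real a * ln y \<le> (sqrt y / 8) * (2 * sqrt y)"
      using ra' sq y by (intro mult_mono) auto
    also have "\<dots> = y / 4" using y by simp
    finally have "(y - 2) * ln 2 \<le> y / 4" using le by (simp add: algebra_simps)
    moreover have y16: "y > 16" using yl power_mono[of 4 lam 2] lam by simp
    moreover have "(y - 2) * (1 / 2) \<le> (y - 2) * ln 2"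
      using ln2_ge_half y16 by (intro mult_left_mono) auto
    ultimately have "(y - 2) * (1 / 2) \<le> y / 4" by linarith
    with y16 show False by simp
  qed
  have "ln y \<le> ln (lam\<^sup>2)" using ylam y lam by (subst ln_le_cancel_iff) auto
  also have "\<dots> = 2 * mu" using lam mu(1) by (simp add: ln_realpow)
  finally have "real r * real a * ln y \<le> real r * real a * (2 * mu)"
    by (intro mult_left_mono) auto
  also have "\<dots> \<le> lam / 4" using ra by simp
  finally have "2 * exp (real r * real a * ln y) \<le> 2 * exp (lam / 4)" by simp
  also have "\<dots> \<le> exp (lam / 4) * exp (lam / 4)"
  proof (rule mult_right_mono)
    have "2 \<le> exp (1::real)" using exp_ge_add_one_self[of "1::real"] by simp
    also have "\<dots> \<le> exp (lam / 4)" using lam by simp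
    finally show "2 \<le> exp (lam / 4)" .
  qed simp
  also have "\<dots> = exp (lam / 2)" by (simp add: exp_add[symmetric])
  finally show "real (card (indep A F)) \<le> exp (lam / 2)" using up by linarith
qed

text \<open>By \<open>rm\<close>, the \<open>r\<close>-th root of \<open>exp (lam / 4)\<close> is at
  least \<open>exp (8 * mu) = lam ^ 8\<close>. The Ramsey bound thus yields \<open>2 ^ b\<close>
  independent sets with \<open>b + 1 \<ge> lam\<^sup>2\<close>, which is enough.\<close>

lemma card_indep_large:
  fixes lam mu :: real
  assumes F: "finite F" "\<And>x y. A x y \<Longrightarrow> A y x" "\<And>x. \<not> A x x" "clique_free A r F"
    and r: "r > 0" and mu: "mu = ln lam" "mu \<ge> 1" and lam: "lam \<ge> 32"
    and rm: "real r * mu \<le> lam / 32" and large: "real (card F) > exp (lam / 4)"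
  shows "exp (10 * lam) \<le> real (card (indep A F))"
proof -
  obtain b where b: "b ^ r \<le> card F" "card F < (b + 1) ^ r" using nat_root_bounds[OF r] .
  define y where "y = real (b + 1)"
  have y: "y \<ge> 1" unfolding y_def by simp
  have "real (card F) \<le> real ((b + 1) ^ r)" using b(2) by (simp only: of_nat_le_iff less_imp_le)
  then have "exp (lam / 4) < y ^ r" using large unfolding y_def by simp
  also have "\<dots> = exp (real r * ln y)" using y exp_of_nat_mult[of r "ln y"] by simp
  finally have "lam / 4 < real r * ln y" by simp
  with rm have "real r * (8 * mu) < real r * ln y" by simp
  then have "8 * mu < ln y" using r by simp
  then have "2 * mu \<le> ln y" using mu(2) by linarith
  then have "lam\<^sup>2 \<le> y"
    using y lam mu(1) ln_le_cancel_iff[of "lam\<^sup>2" y] by (simp add: ln_realpow)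
  moreover have "32 * lam \<le> lam\<^sup>2"
    using mult_right_mono[of 32 lam lam] lam by (simp add: power2_eq_square)
  ultimately have "32 * lam \<le> y" by linarith
  then have "10 * lam \<le> (y - 1) * (1 / 2)" using lam by simp
  also have "\<dots> \<le> real b * ln 2"
    using ln2_ge_half mult_left_mono[of "1/2" "ln 2" "real b"] by (simp add: y_def)
  finally have "exp (10 * lam) \<le> exp (real b * ln 2)" by simp
  also have "\<dots> = real (2 ^ b)" using exp_of_nat_mult[of b "ln (2::real)"] by simp
  also have "\<dots> \<le> real (card (indep A F))"
    using card_indep_ge_power[OF F b(1)] by (simp only: of_nat_le_iff)
  finally show ?thesis .
qed

text \<open>
  The weight of the empty trace detects available colors. The weight \<open>exp (- 2 * p)\<close> of large
  traces is chosen such that both cases of the dichotomy yield the same factor \<open>1 - p / 2\<close>.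
\<close>
lemma sum_indep_weight_le:
  fixes lam mu p :: real
  assumes F: "finite F" "\<And>x y. A x y \<Longrightarrow> A y x" "\<And>x. \<not> A x x" "clique_free A r F"
    and r: "r > 0" and mu: "mu = ln lam" "mu \<ge> 1" and lam: "lam \<ge> 4"
    and ra: "real r * real a * mu \<le> lam / 8" and p: "p = exp (- lam / 2)" and a: "a > 0"
    and g: "g = (\<lambda>n::nat. if n = 0 then exp (-1) else if a \<le> n then exp (- 2 * p) else 1)"
  shows "(\<Sum>K\<in>indep A F. g (card K)) \<le> (1 - p / 2) * card (indep A F)"
proof -
  let ?N = "real (card (indep A F))"
  have fin: "finite (indep A F)" using F(1) by simp
  have e1: "exp (-1::real) \<le> 1 / 2"
    using exp_ge_add_one_self[of "1::real"] by (simp add: exp_minus field_simps)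
  have "p \<le> exp (-1)" unfolding p using lam by simp
  then have p2: "p \<le> 1 / 2" using e1 by linarith
  have p0: "p > 0" unfolding p by simp
  \<comment> \<open>This holds because \<open>p \<le> 1 / 2\<close> makes
    \<open>(1 - p) * (1 + 2 * p)\<close> at least \<open>1\<close>.\<close>
  have e2: "exp (- 2 * p) \<le> 1 - p"
  proof -
    have "1 \<le> (1 - p) * (1 + 2 * p)"
      using p0 p2 mult_right_mono[of p "1/2" p] by (simp add: algebra_simps)
    also have "\<dots> \<le> (1 - p) * exp (2 * p)"
      using p2 exp_ge_add_one_self[of "2 * p"] by (intro mult_left_mono) auto
    finally show ?thesis by (simp add: exp_minus field_simps)
  qed
  have g1: "g n \<le> 1" for n using p0 unfolding g by simp
  from card_indep_dichotomy[OF F r mu lam ra] show ?thesis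
  proof
    \<comment> \<open>With so few sets, \<open>p * ?N \<le> 1\<close>, and the empty set alone saves
      \<open>1 / 2\<close>.\<close>
    assume light: "?N \<le> exp (lam / 2)"
    have "p * ?N \<le> p * exp (lam / 2)" using light p0 by (intro mult_left_mono) auto
    also have "\<dots> = 1" unfolding p by (simp add: exp_add[symmetric])
    finally have pN: "p * ?N \<le> 1" .
    have "(\<Sum>K\<in>indep A F. g (card K)) = g 0 + (\<Sum>K\<in>indep A F - {{}}. g (card K))"
      using sum.remove[OF fin empty_in_indep, of "\<lambda>K. g (card K)"] by simp
    also have "(\<Sum>K\<in>indep A F - {{}}. g (card K)) \<le> (\<Sum>K\<in>indep A F - {{}}. 1)"
      by (intro sum_mono g1)
    also have "\<dots> = ?N - 1"
      using fin card_indep_pos[OF F(1), of A] by (simp add: card_Diff_singleton of_nat_diff)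
    also have "g 0 \<le> 1 / 2" using e1 unfolding g by simp
    finally show ?thesis using pN by (simp add: algebra_simps)
  next
    \<comment> \<open>Here at least half of the summands lose \<open>p\<close> each.\<close>
    assume heavy: "card (indep A F) \<le> 2 * card {I \<in> indep A F. a \<le> card I}"
    have "(\<Sum>K\<in>indep A F. g (card K)) \<le> (\<Sum>K\<in>indep A F. 1 - (if a \<le> card K then p else 0))"
    proof (intro sum_mono)
      fix K show "g (card K) \<le> 1 - (if a \<le> card K then p else 0)"
        using e2 a p0 unfolding g by auto
    qed
    also have "\<dots> = ?N - (\<Sum>K\<in>indep A F. if a \<le> card K then p else 0)"
      by (simp add: sum_subtractf)
    also have "(\<Sum>K\<in>indep A F. if a \<le> card K then p else 0) = p * card {I \<in> indep A F. a \<le> card I}"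
      using fin by (simp add: sum.inter_filter[symmetric])
    also have "?N - p * card {I \<in> indep A F. a \<le> card I} \<le> ?N - p * (?N / 2)"
    proof -
      have "?N \<le> real (2 * card {I \<in> indep A F. a \<le> card I})"
        using heavy by (simp only: of_nat_le_iff)
      then show ?thesis using p0 by (intro diff_left_mono mult_left_mono) auto
    qed
    finally show ?thesis by (simp add: algebra_simps)
  qed
qed

text \<open>Exponential moments: the product of the weights has mean at most
  \<open>exp (- p * card T / 2)\<close>. On the event, fewer than \<open>p * card T / 8\<close>
  traces are empty, and at most an eighth are large because disjoint traces have at most
  \<open>D\<close> elements in total. So the product is at least
  \<open>exp (- 3 * p * card T / 8)\<close> there, and Markov's inequality leaves the difference of
  the exponents.\<close>

lemma few_available_rare:
  fixes lam mu p :: real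
  assumes X: "finite X" and A: "\<And>x y. A x y \<Longrightarrow> A y x" "\<And>x. \<not> A x x"
    and r: "r > 0" and mu: "mu = ln lam" "mu \<ge> 1" and lam: "lam \<ge> 4"
    and ra: "real r * real a * mu \<le> lam / 8" and p: "p = exp (- lam / 2)" and a: "a > 0"
    and T: "finite T" "\<And>x. x \<in> T \<Longrightarrow> M x \<subseteq> X" "\<And>x. x \<in> T \<Longrightarrow> clique_free A r (M x)"
      "\<And>x y. x \<in> T \<Longrightarrow> y \<in> T \<Longrightarrow> x \<noteq> y \<Longrightarrow> M x \<inter> M y = {}"
    and size: "\<And>I. I \<in> indep A X \<Longrightarrow> card I \<le> D" "8 * D \<le> a * card T"
  shows "real (card {I \<in> indep A X. real (card {x \<in> T. I \<inter> M x = {}}) < p * card T / 8})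
    \<le> exp (- p * card T / 8) * card (indep A X)"
proof -
  define g where "g = (\<lambda>n::nat. if n = 0 then exp (-1) else if a \<le> n then exp (- 2 * p) else 1)"
  let ?k = "real (card T)"
  let ?B = "{I \<in> indep A X. real (card {x \<in> T. I \<inter> M x = {}}) < p * ?k / 8}"
  let ?P = "\<lambda>I. \<Prod>x\<in>T. g (card (I \<inter> M x))"
  have p0: "p > 0" unfolding p by simp
  have p1: "p \<le> 1" unfolding p using lam by simp
  have g0: "g n \<ge> 0" for n unfolding g_def by simp
  have "(\<Sum>I\<in>indep A X. ?P I) \<le> (1 - p / 2) ^ card T * card (indep A X)"
  proof (rule sum_indep_prod_le[OF X A(1) T(1,2,4) g0])
    fix x F assume x: "x \<in> T" and F: "F \<subseteq> M x"
    show "(\<Sum>K\<in>indep A F. g (card K)) \<le> (1 - p / 2) * card (indep A F)"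
    proof (rule sum_indep_weight_le[OF _ A _ r mu lam ra p a g_def])
      show "finite F" using F T(2)[OF x] X by (meson finite_subset subset_trans)
      show "clique_free A r F" using clique_free_mono[OF T(3)[OF x] F] .
    qed
  qed (use p1 in auto)
  also have "(1 - p / 2) ^ card T \<le> exp (- p / 2) ^ card T"
    using p1 exp_ge_add_one_self[of "- p / 2"] by (intro power_mono) auto
  also have "\<dots> = exp (- p * ?k / 2)" by (simp add: exp_of_nat_mult[symmetric])
  finally have total: "(\<Sum>I\<in>indep A X. ?P I) \<le> exp (- p * ?k / 2) * card (indep A X)"
    by (simp add: mult_right_mono)
  have low: "exp (- 3 * p * ?k / 8) \<le> ?P I" if I: "I \<in> ?B" for I
  proof -
    have fI: "finite I" using I X indepD(1) by (metis (no_types, lifting) finite_subset mem_Collect_eq)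
    let ?E = "{x \<in> T. I \<inter> M x = {}}" and ?H = "{x \<in> T. a \<le> card (I \<inter> M x)}"
    have "a * card ?H = (\<Sum>x\<in>?H. a)" by simp
    also have "\<dots> \<le> (\<Sum>x\<in>?H. card (I \<inter> M x))" by (intro sum_mono) auto
    also have "\<dots> = card (\<Union>x\<in>?H. I \<inter> M x)"
      using T(1,4) fI by (intro card_UN_disjoint[symmetric]) auto
    also have "\<dots> \<le> card I" using fI by (intro card_mono) auto
    also have "\<dots> \<le> D" using size(1) I by blast
    finally have "8 * (a * card ?H) \<le> a * card T" using size(2) by linarith
    then have "a * (8 * card ?H) \<le> a * card T" by (simp add: mult_ac)
    then have "8 * card ?H \<le> card T" using a by simp
    then have H: "real (card ?H) \<le> ?k / 8" by linarith
    have weight: "exp (- (if x \<in> ?E then 1 else 0) - (if x \<in> ?H then 2 * p else 0))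
        \<le> g (card (I \<inter> M x))" if "x \<in> T" for x
      using that a p0 fI unfolding g_def by auto
    have "real (card ?E) + 2 * p * card ?H \<le> p * ?k / 8 + 2 * p * (?k / 8)"
      using I H p0 by (intro add_mono mult_left_mono) auto
    then have "exp (- 3 * p * ?k / 8) \<le> exp (- (real (card ?E) + 2 * p * card ?H))"
      by simp
    also have "real (card ?E) + 2 * p * card ?H =
        (\<Sum>x\<in>T. (if x \<in> ?E then 1 else 0) + (if x \<in> ?H then 2 * p else 0))"
      using T(1) by (simp add: sum.distrib sum.inter_filter[symmetric])
    also have "exp (- \<dots>) = (\<Prod>x\<in>T. exp (- (if x \<in> ?E then 1 else 0) - (if x \<in> ?H then 2 * p else 0)))"
      unfolding sum_negf[symmetric] exp_sum[OF T(1)] by (simp only: minus_add_distrib diff_conv_add_uminus)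
    also have "\<dots> \<le> ?P I" using weight by (intro prod_mono) auto
    finally show ?thesis .
  qed
  have "card ?B * exp (- 3 * p * ?k / 8) = (\<Sum>I\<in>?B. exp (- 3 * p * ?k / 8))" by simp
  also have "\<dots> \<le> (\<Sum>I\<in>?B. ?P I)" by (intro sum_mono low)
  also have "\<dots> \<le> (\<Sum>I\<in>indep A X. ?P I)"
    using X g0 by (intro sum_mono2 prod_nonneg) auto
  also note total
  also have "exp (- p * ?k / 2) * card (indep A X) =
      (exp (- p * ?k / 8) * card (indep A X)) * exp (- 3 * p * ?k / 8)"
    by (simp add: exp_add[symmetric] mult_ac)
  finally show ?thesis by simp
qed

text \<open>Fix \<open>I\<close> outside \<open>M\<close>. The event then requires an empty trace on
  \<open>M\<close>, one outcome among at least \<open>exp (10 * lam)\<close> when many vertices of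
  \<open>M\<close> are unblocked.\<close>

lemma free_large_rare:
  fixes lam mu :: real
  assumes X: "finite X" and A: "\<And>x y. A x y \<Longrightarrow> A y x" "\<And>x. \<not> A x x"
    and r: "r > 0" and mu: "mu = ln lam" "mu \<ge> 1" and lam: "lam \<ge> 32"
    and rm: "real r * mu \<le> lam / 32"
    and M: "M \<subseteq> X" "clique_free A r M"
  shows "real (card {I \<in> indep A X. I \<inter> M = {} \<and> exp (lam / 4) < real (card {y \<in> M. \<forall>z\<in>I. \<not> A y z})})
    \<le> exp (- 10 * lam) * card (indep A X)"
proof -
  let ?F = "\<lambda>J. {y \<in> M. \<forall>z\<in>J. \<not> A y z}"
  let ?Q = "\<lambda>I. I \<inter> M = {} \<and> exp (lam / 4) < real (card (?F I))"
  have fM: "finite M" using M(1) X by (rule finite_subset)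
  have step: "real (card {K \<in> indep A (?F J). ?Q (J \<union> K)}) \<le> exp (- 10 * lam) * card (indep A (?F J))"
    for J
  proof (cases "exp (lam / 4) < real (card (?F J))")
    case True
    have "{K \<in> indep A (?F J). ?Q (J \<union> K)} \<subseteq> {{}}" by (auto simp: indep_def)
    then have "card {K \<in> indep A (?F J). ?Q (J \<union> K)} \<le> card {{} :: 'a set}"
      by (intro card_mono) auto
    then have "real (card {K \<in> indep A (?F J). ?Q (J \<union> K)}) \<le> exp (- 10 * lam) * exp (10 * lam)"
      by (simp add: exp_add[symmetric])
    also have "\<dots> \<le> exp (- 10 * lam) * card (indep A (?F J))"
      using fM True clique_free_mono[OF M(2), of "?F J"]
      by (intro mult_left_mono card_indep_large[OF _ A _ r mu lam rm]) auto
    finally show ?thesis .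
  next
    case False
    have "{K \<in> indep A (?F J). ?Q (J \<union> K)} = {}"
    proof (rule equals0I)
      fix K assume K: "K \<in> {K \<in> indep A (?F J). ?Q (J \<union> K)}"
      have "K = {}" using K by (auto simp: indep_def)
      with K False show False by simp
    qed
    then show ?thesis by (simp only: card.empty) simp
  qed
  have "real (card {I \<in> indep A X. ?Q I}) =
      (\<Sum>J\<in>indep A (X - M). real (card {K \<in> indep A (?F J). ?Q (J \<union> K)}))"
    by (subst card_Collect_indep_split[OF X M(1) A(1)]) simp_all
  also have "\<dots> \<le> (\<Sum>J\<in>indep A (X - M). exp (- 10 * lam) * card (indep A (?F J)))"
    by (intro sum_mono step)
  also have "\<dots> = exp (- 10 * lam) * card (indep A X)"
    by (subst card_indep_split[OF X M(1) A(1)]) (simp_all add: sum_distrib_left)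
  finally show ?thesis .
qed

section \<open>Lopsided local lemma and colorings from large lists\<close>

text \<open>
  \<open>c v I\<close> is the part of the configuration \<open>I\<close> that remains when \<open>v\<close> is resampled; events
  outside \<open>\<Gamma> v\<close> may depend on nothing else.
\<close>
lemma lopsided_local_lemma:
  fixes p :: real and Bad :: "'a \<Rightarrow> 'c set"
  assumes fin: "finite V" "finite \<Omega>" "\<Omega> \<noteq> {}"
    and D: "\<And>v. v \<in> V \<Longrightarrow> card (\<Gamma> v) \<le> D" "D > 0" "\<And>v. v \<in> V \<Longrightarrow> finite (\<Gamma> v)"
    and far: "\<And>v w I I'. \<lbrakk>v \<in> V; w \<in> V; w \<notin> \<Gamma> v; I \<in> \<Omega>; I' \<in> \<Omega>; c v I = c v I'; I \<in> Bad w\<rbrakk>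
        \<Longrightarrow> I' \<in> Bad w"
    and local: "\<And>v I. v \<in> V \<Longrightarrow> I \<in> \<Omega> \<Longrightarrow>
        real (card {I' \<in> \<Omega>. c v I' = c v I \<and> I' \<in> Bad v}) \<le> p * card {I' \<in> \<Omega>. c v I' = c v I}"
    and p: "0 \<le> p" "4 * p * D \<le> 1"
  shows "\<exists>I\<in>\<Omega>. \<forall>v\<in>V. I \<notin> Bad v"
proof -
  define Good where "Good T = {I \<in> \<Omega>. \<forall>w\<in>T. I \<notin> Bad w}" for T
  have finG: "finite (Good T)" for T using fin(2) unfolding Good_def by simp
  \<comment> \<open>By \<open>far\<close>, \<open>Good T\<close> is a union of classes of
    \<open>c v\<close>, and \<open>local\<close> bounds the share of \<open>Bad v\<close> in each
    class.\<close>
  have far_bound: "real (card (Good T \<inter> Bad v)) \<le> p * card (Good T)"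
    if v: "v \<in> V" and T: "T \<subseteq> V - \<Gamma> v" for v T
  proof -
    let ?cl = "\<lambda>z. {I \<in> \<Omega>. c v I = z}"
    have cl: "{I \<in> Good T. c v I = z} = ?cl z" if z: "z \<in> c v ` Good T" for z
    proof -
      obtain I0 where I0: "I0 \<in> Good T" "z = c v I0" using z by blast
      have "I \<in> Good T" if "I \<in> \<Omega>" "c v I = z" for I
        using far[OF v _ _ that(1), of _ I0] that I0 T unfolding Good_def by auto
      then show ?thesis unfolding Good_def by auto
    qed
    have eq: "card S = (\<Sum>z\<in>c v ` Good T. card {I \<in> S. c v I = z})" if "S \<subseteq> Good T" for S
    proof -
      have "S = (\<Union>z\<in>c v ` Good T. {I \<in> S. c v I = z})" using that by auto
      then have "card S = card (\<Union>z\<in>c v ` Good T. {I \<in> S. c v I = z})" by simp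
      also have "\<dots> = (\<Sum>z\<in>c v ` Good T. card {I \<in> S. c v I = z})"
        using finG finite_subset[OF that finG] by (intro card_UN_disjoint) auto
      finally show ?thesis .
    qed
    have "real (card (Good T \<inter> Bad v)) =
        (\<Sum>z\<in>c v ` Good T. real (card {I \<in> Good T \<inter> Bad v. c v I = z}))"
      by (subst eq) auto
    also have "\<dots> \<le> (\<Sum>z\<in>c v ` Good T. p * card {I \<in> Good T. c v I = z})"
    proof (intro sum_mono)
      fix z assume z: "z \<in> c v ` Good T"
      then obtain I0 where I0: "I0 \<in> \<Omega>" "z = c v I0" unfolding Good_def by blast
      have "{I \<in> Good T \<inter> Bad v. c v I = z} = {I' \<in> \<Omega>. c v I' = c v I0 \<and> I' \<in> Bad v}"
        using cl[OF z] I0(2) by auto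
      then show "real (card {I \<in> Good T \<inter> Bad v. c v I = z}) \<le> p * card {I \<in> Good T. c v I = z}"
        using local[OF v I0(1)] cl[OF z] I0(2) by simp
    qed
    also have "\<dots> = p * card (Good T)"
      by (subst eq[of "Good T"]) (auto simp: sum_distrib_left)
    finally show ?thesis .
  qed
  \<comment> \<open>Dropping the at most \<open>D\<close> conditions in \<open>\<Gamma> v\<close>
    gives \<open>T2\<close>. By induction each of them removes at most a share \<open>2 * p\<close>
    of \<open>Good T2\<close>, together at most half, so the bound \<open>p\<close> relative to
    \<open>Good T2\<close> at most doubles.\<close>
  have main: "real (card (Good T \<inter> Bad v)) \<le> 2 * p * card (Good T)"
    if "v \<in> V" "T \<subseteq> V" for v T
    using that
  proof (induction "card T" arbitrary: T v rule: less_induct)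
    case less
    have finT: "finite T" using less.prems(2) fin(1) by (rule finite_subset)
    define T1 T2 where "T1 = T \<inter> \<Gamma> v" and "T2 = T - \<Gamma> v"
    have T2: "T2 \<subseteq> V - \<Gamma> v" "T2 \<subseteq> V" using less.prems unfolding T2_def by auto
    have T1: "T1 \<subseteq> V" using less.prems unfolding T1_def by auto
    have "Good T \<inter> Bad v \<subseteq> Good T2 \<inter> Bad v" unfolding Good_def T2_def by auto
    then have "card (Good T \<inter> Bad v) \<le> card (Good T2 \<inter> Bad v)"
      using finG by (intro card_mono) auto
    then have up: "real (card (Good T \<inter> Bad v)) \<le> p * card (Good T2)"
      using far_bound[OF less.prems(1) T2(1)] by linarith
    have "Good T2 \<subseteq> Good T \<union> (\<Union>w\<in>T1. Good T2 \<inter> Bad w)"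
      unfolding Good_def T1_def T2_def by auto
    then have "card (Good T2) \<le> card (Good T \<union> (\<Union>w\<in>T1. Good T2 \<inter> Bad w))"
      using finG finT unfolding T1_def by (intro card_mono) auto
    also have "\<dots> \<le> card (Good T) + card (\<Union>w\<in>T1. Good T2 \<inter> Bad w)" by (rule card_Un_le)
    also have "card (\<Union>w\<in>T1. Good T2 \<inter> Bad w) \<le> (\<Sum>w\<in>T1. card (Good T2 \<inter> Bad w))"
      using finT unfolding T1_def by (intro card_UN_le) auto
    finally have "real (card (Good T2)) \<le> real (card (Good T) + (\<Sum>w\<in>T1. card (Good T2 \<inter> Bad w)))"
      by (simp only: of_nat_le_iff add_left_mono)
    also have "\<dots> = card (Good T) + (\<Sum>w\<in>T1. real (card (Good T2 \<inter> Bad w)))" by simp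
    also have "(\<Sum>w\<in>T1. real (card (Good T2 \<inter> Bad w))) \<le> (\<Sum>w\<in>T1. 2 * p * card (Good T2))"
    proof (intro sum_mono)
      fix w assume w: "w \<in> T1"
      then have "T2 \<subset> T" unfolding T1_def T2_def by auto
      then have "card T2 < card T" using finT by (rule psubset_card_mono[rotated])
      then show "real (card (Good T2 \<inter> Bad w)) \<le> 2 * p * card (Good T2)"
        using less.hyps w T1 T2(2) by blast
    qed
    also have "\<dots> = card T1 * (2 * p * card (Good T2))" by simp
    also have "\<dots> \<le> D * (2 * p * card (Good T2))"
    proof (intro mult_right_mono)
      have "card T1 \<le> card (\<Gamma> v)"
        using D(3) less.prems(1) unfolding T1_def by (intro card_mono) auto
      then show "real (card T1) \<le> real D" using D(1)[OF less.prems(1)] by simp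
    qed (use p(1) in auto)
    also have "\<dots> = (4 * p * D) * (card (Good T2) / 2)" by simp
    also have "\<dots> \<le> 1 * (card (Good T2) / 2)" using p(2) by (intro mult_right_mono) auto
    finally have "real (card (Good T2)) \<le> 2 * card (Good T)" by simp
    then have "p * card (Good T2) \<le> p * (2 * card (Good T))" using p(1) by (rule mult_left_mono)
    then show ?case using up by simp
  qed
  have "p * 1 \<le> p * D" using p(1) D(2) by (intro mult_left_mono) auto
  then have p2: "2 * p \<le> 1 / 2" using p(2) by simp
  \<comment> \<open>Each further event excludes at most half of the remaining
    configurations.\<close>
  have "card (Good T) > 0" if "T \<subseteq> V" for T
    using finite_subset[OF that fin(1)] that
  proof (induction T rule: finite_induct)
    case empty
    then show ?case using fin(2,3) unfolding Good_def by (simp add: card_gt_0_iff)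
  next
    case (insert v T)
    have "Good (insert v T) = Good T - Good T \<inter> Bad v" unfolding Good_def by auto
    then have "card (Good (insert v T)) = card (Good T) - card (Good T \<inter> Bad v)"
      using finG by (simp add: card_Diff_subset)
    moreover have "real (card (Good T \<inter> Bad v)) \<le> 1 / 2 * card (Good T)"
      using main[of v T] insert.prems mult_right_mono[OF p2, of "card (Good T)"] by auto
    moreover have "card (Good T) > 0" using insert by simp
    ultimately show ?case by linarith
  qed
  from this[of V] show ?thesis unfolding Good_def by (fastforce simp: card_gt_0_iff)
qed

text \<open>A self-improving count: growth by the factor \<open>s / 2\<close> on smaller sets shows
  that at most a share \<open>2 / s\<close> of the proper choices takes a fixed value
  \<open>y\<close> at \<open>u\<close>. Hence the at most \<open>s / 4\<close> conflicts of a color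
  block at most half of the choices, which gives the growth for the next vertex.\<close>

lemma proper_choice_exists:
  fixes L :: "'a \<Rightarrow> 'b set"
  assumes fin: "finite U" "\<And>u. u \<in> U \<Longrightarrow> finite (L u)"
    and size: "\<And>u. u \<in> U \<Longrightarrow> s \<le> real (card (L u))" "4 * d \<le> s" "s > 0"
    and deg: "\<And>u x. u \<in> U \<Longrightarrow> x \<in> L u \<Longrightarrow>
        real (card {(v, y). v \<in> U \<and> v \<noteq> u \<and> y \<in> L v \<and> A x y}) \<le> d"
    and sym: "\<And>x y. A x y \<Longrightarrow> A y x"
  shows "\<exists>\<phi>. \<forall>u\<in>U. \<phi> u \<in> L u \<and> (\<forall>v\<in>U. v \<noteq> u \<longrightarrow> \<not> A (\<phi> u) (\<phi> v))"
proof -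
  define Z where "Z S = {\<phi> \<in> Pi\<^sub>E S L. \<forall>u\<in>S. \<forall>v\<in>S. v \<noteq> u \<longrightarrow> \<not> A (\<phi> u) (\<phi> v)}" for S
  have finZ: "finite (Z S)" if "S \<subseteq> U" for S
  proof -
    have "finite (Pi\<^sub>E S L)" using that fin by (intro finite_PiE) (auto dest: finite_subset)
    then show ?thesis unfolding Z_def by simp
  qed
  \<comment> \<open>Restriction to \<open>S\<close> forgets only the value at \<open>u\<close>,
    which is fixed to \<open>y\<close>.\<close>
  have fibre: "card {\<phi> \<in> Z (insert u S). \<phi> u = y} \<le> card (Z S)"
    if S: "insert u S \<subseteq> U" "u \<notin> S" for u S y
  proof (rule card_inj_on_le[of "\<lambda>\<phi>. restrict \<phi> S"])
    show "inj_on (\<lambda>\<phi>. restrict \<phi> S) {\<phi> \<in> Z (insert u S). \<phi> u = y}"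
    proof (rule inj_onI)
      fix \<phi> \<psi> assume *: "\<phi> \<in> {\<phi> \<in> Z (insert u S). \<phi> u = y}" "\<psi> \<in> {\<phi> \<in> Z (insert u S). \<phi> u = y}"
        "restrict \<phi> S = restrict \<psi> S"
      then have "\<phi> \<in> Pi\<^sub>E (insert u S) L" "\<psi> \<in> Pi\<^sub>E (insert u S) L" unfolding Z_def by auto
      then show "\<phi> = \<psi>"
      proof (rule PiE_ext)
        fix i assume "i \<in> insert u S"
        then show "\<phi> i = \<psi> i" using *(1,2) fun_cong[OF *(3), of i] by (cases "i = u") auto
      qed
    qed
    show "(\<lambda>\<phi>. restrict \<phi> S) ` {\<phi> \<in> Z (insert u S). \<phi> u = y} \<subseteq> Z S"
      unfolding Z_def by (auto simp: PiE_iff)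
    show "finite (Z S)" using S finZ by auto
  qed
  have step: "s / 2 * card (Z S) \<le> card (Z (insert v S))"
    if "S \<subseteq> U" "v \<in> U" "v \<notin> S" for S v
    using that
  proof (induction "card S" arbitrary: S v rule: less_induct)
    case less
    note S = less.prems
    have finS: "finite S" using S(1) fin(1) by (rule finite_subset)
    let ?E = "\<lambda>x. {(u, y). u \<in> S \<and> y \<in> L u \<and> A x y}"
    let ?bl = "\<lambda>x. {\<phi> \<in> Z S. \<exists>u\<in>S. A x (\<phi> u)}"
    have blocked: "real (card (?bl x)) \<le> card (Z S) / 2" if x: "x \<in> L v" for x
    proof -
      let ?E' = "{(u, y). u \<in> U \<and> u \<noteq> v \<and> y \<in> L u \<and> A x y}"
      have finE': "finite ?E'"
        by (rule finite_subset[of _ "Sigma U L"]) (use fin in auto)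
      have sub: "?E x \<subseteq> ?E'" using S by auto
      have finE: "finite (?E x)" using sub finE' by (rule finite_subset)
      have "card (?E x) \<le> card ?E'" using finE' sub by (rule card_mono)
      then have E: "real (card (?E x)) \<le> d" using deg[OF S(2) x] by linarith
      have "?bl x \<subseteq> (\<Union>(u, y)\<in>?E x. {\<phi> \<in> Z S. \<phi> u = y})"
        unfolding Z_def by (auto simp: PiE_iff)
      then have "card (?bl x) \<le> card (\<Union>(u, y)\<in>?E x. {\<phi> \<in> Z S. \<phi> u = y})"
        using finE finZ[OF S(1)] by (intro card_mono) auto
      also have "\<dots> \<le> (\<Sum>e\<in>?E x. card {\<phi> \<in> Z S. \<phi> (fst e) = snd e})"
        using card_UN_le[OF finE, of "\<lambda>e. {\<phi> \<in> Z S. \<phi> (fst e) = snd e}"]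
        by (simp add: case_prod_beta)
      finally have union: "card (?bl x) \<le> (\<Sum>e\<in>?E x. card {\<phi> \<in> Z S. \<phi> (fst e) = snd e})" .
      have "s / 2 * real (card (?bl x)) \<le>
          s / 2 * real (\<Sum>e\<in>?E x. card {\<phi> \<in> Z S. \<phi> (fst e) = snd e})"
        by (rule mult_left_mono[OF of_nat_mono[OF union]]) (use size(3) in simp)
      also have "\<dots> = (\<Sum>e\<in>?E x. s / 2 * real (card {\<phi> \<in> Z S. \<phi> (fst e) = snd e}))"
        by (simp add: sum_distrib_left)
      also have "\<dots> \<le> (\<Sum>e\<in>?E x. real (card (Z S)))"
      proof (intro sum_mono)
        fix e assume "e \<in> ?E x"
        then have u: "fst e \<in> S" by auto
        then have ins: "insert (fst e) (S - {fst e}) = S" by auto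
        have lt: "card (S - {fst e}) < card S" using u finS by (rule card_Diff1_less[rotated])
        have "card {\<phi> \<in> Z S. \<phi> (fst e) = snd e} \<le> card (Z (S - {fst e}))"
          using fibre[of "fst e" "S - {fst e}" "snd e"] S(1) unfolding ins by simp
        then have "s / 2 * real (card {\<phi> \<in> Z S. \<phi> (fst e) = snd e}) \<le> s / 2 * card (Z (S - {fst e}))"
          using size(3) by (intro mult_left_mono) auto
        also have "\<dots> \<le> card (Z S)"
          using less.hyps[OF lt, of "fst e"] S(1) u unfolding ins by auto
        finally show "s / 2 * real (card {\<phi> \<in> Z S. \<phi> (fst e) = snd e}) \<le> real (card (Z S))" .
      qed
      also have "\<dots> = card (?E x) * real (card (Z S))" by simp
      also have "\<dots> \<le> (s / 4) * real (card (Z S))"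
        using E size(2) by (intro mult_right_mono) auto
      finally have "s * (2 * real (card (?bl x))) \<le> s * real (card (Z S))" by (simp add: field_simps)
      then show ?thesis using size(3) by simp
    qed
    have finv: "finite (L v)" using fin(2) S(2) .
    let ?ok = "\<lambda>x. Z S - ?bl x"
    \<comment> \<open>Choices in \<open>Z S\<close> have the default value at \<open>v\<close>, so
      both the new color and the old choice can be read off.\<close>
    have "inj_on (\<lambda>(x, \<phi>). \<phi>(v := x)) (Sigma (L v) ?ok)"
    proof (rule inj_onI)
      fix e e' assume e: "e \<in> Sigma (L v) ?ok" "e' \<in> Sigma (L v) ?ok"
        and "(case e of (x, \<phi>) \<Rightarrow> \<phi>(v := x)) = (case e' of (x, \<phi>) \<Rightarrow> \<phi>(v := x))"
      then have eq: "(snd e)(v := fst e) = (snd e')(v := fst e')" by (simp add: case_prod_beta)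
      have Z: "snd e \<in> Z S" "snd e' \<in> Z S" using e by auto
      have "snd e i = snd e' i" for i
      proof (cases "i = v")
        case True
        then show ?thesis using Z S(3) unfolding Z_def by (auto simp: PiE_iff extensional_def)
      next
        case False
        then show ?thesis using fun_cong[OF eq, of i] by simp
      qed
      then show "e = e'" using fun_cong[OF eq, of v] by (auto simp: prod_eq_iff)
    qed
    moreover have "(\<lambda>(x, \<phi>). \<phi>(v := x)) ` Sigma (L v) ?ok \<subseteq> Z (insert v S)"
    proof (rule image_subsetI)
      fix e assume "e \<in> Sigma (L v) ?ok"
      then obtain x \<phi> where e: "e = (x, \<phi>)" and x: "x \<in> L v"
        and \<phi>: "\<phi> \<in> Z S" "\<And>u. u \<in> S \<Longrightarrow> \<not> A x (\<phi> u)" by auto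
      have "\<not> A (\<phi> u) x" if "u \<in> S" for u using \<phi> that sym by blast
      then show "(case e of (x, \<phi>) \<Rightarrow> \<phi>(v := x)) \<in> Z (insert v S)"
        using e x \<phi> S(3) unfolding Z_def by (auto simp: PiE_iff extensional_def)
    qed
    ultimately have "card (Sigma (L v) ?ok) \<le> card (Z (insert v S))"
      using finZ[of "insert v S"] S by (intro card_inj_on_le) auto
    moreover have "card (Sigma (L v) ?ok) = (\<Sum>x\<in>L v. card (?ok x))"
      using finv finZ[OF S(1)] by (intro card_SigmaI) auto
    ultimately have "real (\<Sum>x\<in>L v. card (?ok x)) \<le> card (Z (insert v S))"
      by (simp only: of_nat_le_iff)
    moreover have "s / 2 * card (Z S) \<le> (\<Sum>x\<in>L v. real (card (?ok x)))"
    proof -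
      have "s / 2 * card (Z S) \<le> card (L v) * (card (Z S) / 2)"
        using mult_right_mono[OF size(1)[OF S(2)], of "card (Z S) / 2"] by simp
      also have "\<dots> = (\<Sum>x\<in>L v. card (Z S) / 2)" by simp
      also have "\<dots> \<le> (\<Sum>x\<in>L v. real (card (?ok x)))"
      proof (intro sum_mono)
        fix x assume "x \<in> L v"
        have "card (?ok x) = card (Z S) - card (?bl x)"
          using finZ[OF S(1)] by (intro card_Diff_subset) auto
        then show "card (Z S) / 2 \<le> real (card (?ok x))" using blocked[OF \<open>x \<in> L v\<close>] by linarith
      qed
      finally show ?thesis .
    qed
    ultimately show ?case by simp
  qed
  have "card (Z S) > 0" if "S \<subseteq> U" for S
    using finite_subset[OF that fin(1)] that
  proof (induction S rule: finite_induct)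
    case empty
    then show ?case unfolding Z_def by simp
  next
    case (insert v S)
    then have "0 < s / 2 * card (Z S)" using size(3) by simp
    also have "\<dots> \<le> card (Z (insert v S))" using insert step by simp
    finally show ?case by simp
  qed
  then obtain \<phi> where "\<phi> \<in> Z U" by (metis card.empty ex_in_conv less_irrefl order_refl)
  then show ?thesis unfolding Z_def by (auto simp: PiE_iff)
qed

section \<open>Partial colorings of a cover\<close>

text \<open>Graph and cover as plain relations on vertices and colors. \<open>A_match\<close> is one
  half of the matching condition; the other half follows with \<open>E_sym\<close> and
  \<open>A_sym\<close>.\<close>

locale list_cover =
  fixes V :: "'a set" and E :: "'a \<Rightarrow> 'a \<Rightarrow> bool"
    and L :: "'a \<Rightarrow> 'b set" and A :: "'b \<Rightarrow> 'b \<Rightarrow> bool" and k D r :: nat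
  assumes finV: "finite V"
    and E_in: "E u v \<Longrightarrow> u \<in> V \<and> v \<in> V" and E_sym: "E u v \<Longrightarrow> E v u"
    and deg: "u \<in> V \<Longrightarrow> card {v. E u v} \<le> D"
    and clique_free: "clique_free E r V"
    and finL: "u \<in> V \<Longrightarrow> finite (L u)" and cardL: "u \<in> V \<Longrightarrow> card (L u) = k"
    and disj: "\<lbrakk>u \<in> V; v \<in> V; x \<in> L u; x \<in> L v\<rbrakk> \<Longrightarrow> u = v"
    and A_sym: "A x y \<Longrightarrow> A y x" and A_irrefl: "\<not> A x x"
    and A_list: "\<lbrakk>u \<in> V; x \<in> L u; y \<in> L u; x \<noteq> y\<rbrakk> \<Longrightarrow> A x y"
    and A_edge: "\<lbrakk>u \<in> V; v \<in> V; x \<in> L u; y \<in> L v; A x y\<rbrakk> \<Longrightarrow> u = v \<or> E u v"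
    and A_match: "\<lbrakk>E u v; x \<in> L u; y \<in> L v; y' \<in> L v; A x y; A x y'\<rbrakk> \<Longrightarrow> y = y'"
begin

section \<open>Neighboring colors and conflict sets\<close>

abbreviation nbrs where "nbrs v \<equiv> {u. E v u}"

definition nbr_colors where "nbr_colors v = (\<Union>u\<in>nbrs v. L u)"
definition colors where "colors = (\<Union>u\<in>V. L u)"
definition conflicts where "conflicts v x = {y \<in> nbr_colors v. A x y}"
definition owner where "owner y = (SOME u. u \<in> V \<and> y \<in> L u)"

lemma finite_nbrs: "finite (nbrs v)"
  by (rule finite_subset[OF _ finV]) (auto dest: E_in)

lemma finite_nbr_colors: "finite (nbr_colors v)"
  unfolding nbr_colors_def using finite_nbrs finL E_in by blast

lemma finite_colors: "finite colors"
  unfolding colors_def using finV finL by blast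

lemma nbr_colors_subset: "nbr_colors v \<subseteq> colors"
  unfolding colors_def nbr_colors_def using E_in by blast

lemma conflicts_subset: "conflicts v x \<subseteq> nbr_colors v"
  unfolding conflicts_def by blast

lemma owner_eq: "u \<in> V \<Longrightarrow> y \<in> L u \<Longrightarrow> owner y = u"
  unfolding owner_def by (rule some_equality) (auto intro: disj)

lemma nbr_colors_owner: "y \<in> nbr_colors v \<Longrightarrow> E v (owner y) \<and> y \<in> L (owner y)"
  unfolding nbr_colors_def using owner_eq E_in by auto

text \<open>By \<open>A_match\<close>, \<open>x\<close> has at most one conflict in each neighboring
  list, so a clique of conflicting colors would project injectively to a clique of their
  owners.\<close>

lemma conflicts_clique_free:
  assumes "v \<in> V" "x \<in> L v"
  shows "clique_free A r (conflicts v x)"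
  unfolding clique_free_def
proof (intro allI impI)
  fix Q assume Q: "Q \<subseteq> conflicts v x" "finite Q" "card Q = r"
  have own: "E v (owner y)" "y \<in> L (owner y)" "A x y" if "y \<in> Q" for y
    using that Q(1) nbr_colors_owner[of y v] unfolding conflicts_def by auto
  have inj: "inj_on owner Q"
  proof (rule inj_onI)
    fix y z assume "y \<in> Q" "z \<in> Q" "owner y = owner z"
    then show "y = z" using A_match[OF own(1)[of y] assms(2), of y z] own[of y] own[of z] by simp
  qed
  have "owner ` Q \<subseteq> V" "finite (owner ` Q)" "card (owner ` Q) = r"
    using own(1) E_in Q inj by (auto simp: card_image)
  then obtain a b where ab: "a \<in> owner ` Q" "b \<in> owner ` Q" "a \<noteq> b" "\<not> E a b"
    using clique_freeD[OF clique_free] by blast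
  then obtain y z where yz: "y \<in> Q" "z \<in> Q" "a = owner y" "b = owner z" by blast
  have "\<not> A y z"
    using A_edge[of a b y z] own(1,2)[OF yz(1)] own(1,2)[OF yz(2)] yz(3,4) ab(3,4) E_in by blast
  moreover have "y \<noteq> z" using yz(3,4) ab(3) by blast
  ultimately show "\<exists>x\<in>Q. \<exists>y\<in>Q. x \<noteq> y \<and> \<not> A x y" using yz(1,2) by blast
qed

text \<open>By the matching condition, a color of a neighbor is adjacent to at most one color of
  \<open>v\<close>.\<close>

lemma conflicts_disjoint:
  assumes "v \<in> V" "x \<in> L v" "x' \<in> L v" "x \<noteq> x'"
  shows "conflicts v x \<inter> conflicts v x' = {}"
proof (rule equals0I)
  fix y assume "y \<in> conflicts v x \<inter> conflicts v x'"
  then have "E (owner y) v" "y \<in> L (owner y)" "A y x" "A y x'"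
    using nbr_colors_owner[of y v] E_sym A_sym unfolding conflicts_def by auto
  then show False using A_match[of "owner y" v y x x'] assms by blast
qed

text \<open>Lists are cliques, so \<open>I\<close> takes at most one color from each of the at most
  \<open>D\<close> lists.\<close>

lemma indep_size:
  assumes "v \<in> V" "Z \<subseteq> nbr_colors v" "I \<in> indep A Z"
  shows "card I \<le> D"
proof -
  have I: "I \<subseteq> nbr_colors v" using assms(2) indepD(1)[OF assms(3)] by blast
  have "inj_on owner I"
  proof (rule inj_onI, rule ccontr)
    fix y z assume yz: "y \<in> I" "z \<in> I" "owner y = owner z" "y \<noteq> z"
    then have "A y z" using nbr_colors_owner[of y v] nbr_colors_owner[of z v] I E_in by (intro A_list[of "owner y"]) auto
    then show False using yz indepD(2)[OF assms(3)] by blast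
  qed
  moreover have "owner ` I \<subseteq> nbrs v" using I nbr_colors_owner by blast
  ultimately have "card I \<le> card (nbrs v)" using finite_nbrs by (rule card_inj_on_le)
  then show ?thesis using deg[OF assms(1)] by simp
qed

section \<open>Bad events and their dependencies\<close>

definition available where "available v I = {x \<in> L v. I \<inter> conflicts v x = {}}"
definition rivals where "rivals v x I = {y \<in> conflicts v x. \<forall>z\<in>I. \<not> A y z}"
text \<open>For \<open>lam = ln D\<close> the thresholds are \<open>k / (8 * sqrt D)\<close>
  available colors and \<open>D powr (1 / 4)\<close> rivals. Availability is judged by the neighbors
  alone, even if \<open>I\<close> contains a color of \<open>v\<close>.\<close>

definition bad where
  "bad lam v = {I. real (card (available v I)) < exp (- lam / 2) * k / 8 \<or>
     (\<exists>x\<in>available v I. exp (lam / 4) < real (card (rivals v x I)))}"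
text \<open>
  \<open>bad lam w\<close> only depends on the colors at \<open>u\<close> and its neighbors, for neighbors \<open>u\<close> of \<open>w\<close>;
  \<open>ball v\<close> contains all \<open>w\<close> for which one of these vertices is a neighbor of \<open>v\<close>.
\<close>
definition ball where "ball v = (\<Union>u\<in>nbrs v. nbrs u \<union> (\<Union>t\<in>nbrs u. nbrs t))"

lemma finite_ball: "finite (ball v)"
  unfolding ball_def using finite_nbrs by blast

lemma card_ball_le:
  assumes "v \<in> V" "D > 0"
  shows "card (ball v) \<le> 2 * D ^ 3"
proof -
  have nbrs: "card (nbrs u) \<le> D" if "u \<in> nbrs v'" for u v' using deg E_in that by blast
  have UN: "card (\<Union>t\<in>S. F t) \<le> D * c"
    if "finite S" "card S \<le> D" "\<And>t. t \<in> S \<Longrightarrow> card (F t) \<le> c" for S c and F :: "'a \<Rightarrow> 'a set"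
  proof -
    have "card (\<Union>t\<in>S. F t) \<le> (\<Sum>t\<in>S. card (F t))" by (rule card_UN_le[OF that(1)])
    also have "\<dots> \<le> card S * c" using that(3) sum_bounded_above[of S "\<lambda>t. card (F t)" c] by simp
    also have "\<dots> \<le> D * c" using that(2) by (rule mult_right_mono) simp
    finally show ?thesis .
  qed
  have "card (nbrs u \<union> (\<Union>t\<in>nbrs u. nbrs t)) \<le> D + D * D" if "u \<in> nbrs v" for u
  proof -
    have "card (\<Union>t\<in>nbrs u. nbrs t) \<le> D * D" using nbrs that by (intro UN finite_nbrs) auto
    then show ?thesis using card_Un_le[of "nbrs u" "\<Union>t\<in>nbrs u. nbrs t"] nbrs[OF that] by linarith
  qed
  then have "card (ball v) \<le> D * (D + D * D)"
    unfolding ball_def using deg[OF assms(1)] by (intro UN finite_nbrs) auto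
  also have "\<dots> \<le> D * (D * D + D * D)" using assms(2) by (intro mult_left_mono add_right_mono) auto
  also have "\<dots> = 2 * D ^ 3" by (simp add: power3_eq_cube)
  finally show ?thesis .
qed

text \<open>The event at \<open>w\<close> reads \<open>I\<close> only on the colors of neighbors of
  \<open>w\<close> and on colors adjacent to those. If such a color were in a list next to
  \<open>v\<close>, a walk of length two or three from \<open>v\<close> to \<open>w\<close> would
  put \<open>w\<close> into \<open>ball v\<close>.\<close>

lemma bad_local:
  assumes "v \<in> V" "w \<in> V" "w \<notin> ball v" "I \<in> indep A colors" "I' \<in> indep A colors" "I - nbr_colors v = I' - nbr_colors v"
    and "I \<in> bad lam w"
  shows "I' \<in> bad lam w"
proof -
  have off: "z \<in> I \<longleftrightarrow> z \<in> I'" if "z \<notin> nbr_colors v" for z using that assms(6) by blast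
  have off_nbr: "y \<notin> nbr_colors v" if y: "y \<in> nbr_colors w" for y
  proof
    assume "y \<in> nbr_colors v"
    then have "E v (owner y)" "E (owner y) w" using nbr_colors_owner y E_sym by blast+
    then show False using assms(3) unfolding ball_def by blast
  qed
  have offA: "z \<notin> nbr_colors v" if y: "y \<in> nbr_colors w" and z: "z \<in> colors" "A y z" for y z
  proof
    assume zv: "z \<in> nbr_colors v"
    then have 1: "E v (owner z)" "z \<in> L (owner z)" using nbr_colors_owner by blast+
    have 2: "E (owner y) w" "y \<in> L (owner y)" using nbr_colors_owner[OF y] E_sym by blast+
    have "owner y = owner z \<or> E (owner z) (owner y)"
      using A_edge[OF _ _ 2(2) 1(2) z(2)] 1(1) 2(1) E_in E_sym by blast
    then show False
    proof
      assume "owner y = owner z"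
      then show False using 1(1) 2(1) assms(3) unfolding ball_def by auto
    next
      assume "E (owner z) (owner y)"
      then show False using 1(1) 2(1) assms(3) unfolding ball_def by blast
    qed
  qed
  have "I \<inter> conflicts w x = I' \<inter> conflicts w x" for x using off off_nbr conflicts_subset by blast
  then have av: "available w I = available w I'" unfolding available_def by simp
  have "(\<forall>z\<in>I. \<not> A y z) \<longleftrightarrow> (\<forall>z\<in>I'. \<not> A y z)" if "y \<in> conflicts w x" for x y
    using offA[of y] off indepD(1)[OF assms(4)] indepD(1)[OF assms(5)] that conflicts_subset by blast
  then have "rivals w x I = rivals w x I'" for x unfolding rivals_def by blast
  with av assms(7) show ?thesis unfolding bad_def by simp
qed

text \<open>With \<open>I0\<close> fixed away from the lists next to \<open>v\<close>, the rest is a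
  uniform independent set of the unblocked colors \<open>Z\<close>. Both tail bounds are applied
  inside \<open>Z\<close>, the second one to each of the \<open>k\<close> colors of
  \<open>v\<close>, and added up.\<close>

lemma card_bad_le:
  fixes lam mu :: real
  assumes v: "v \<in> V" and I0: "I0 \<in> indep A colors" and r: "r > 0" and mu: "mu = ln lam" "mu \<ge> 1"
    and lam: "lam \<ge> 32" and ra: "real r * real a * mu \<le> lam / 8" and a: "a > 0"
    and ak: "8 * D \<le> a * k" and rm: "real r * mu \<le> lam / 32"
  shows "real (card {I \<in> indep A colors. I - nbr_colors v = I0 - nbr_colors v \<and> I \<in> bad lam v})
    \<le> (exp (- exp (- lam / 2) * k / 8) + k * exp (- 10 * lam)) * card {I \<in> indep A colors. I - nbr_colors v = I0 - nbr_colors v}"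
proof -
  let ?p = "exp (- lam / 2)"
  define J where "J = I0 - nbr_colors v"
  define Z where "Z = {y \<in> nbr_colors v. \<forall>z\<in>J. \<not> A y z}"
  have J: "J \<in> indep A (colors - nbr_colors v)" using I0 unfolding J_def indep_def by auto
  have ZY: "Z \<subseteq> nbr_colors v" unfolding Z_def by auto
  have finZ: "finite Z" using ZY finite_nbr_colors by (rule finite_subset)
  \<comment> \<open>\<open>P\<close> is left open so that the bijection serves both the bad
    configurations and, with \<open>P\<close> always true, the whole class.\<close>
  have cls: "card {I \<in> indep A colors. I - nbr_colors v = J \<and> P I} = card {K \<in> indep A Z. P (J \<union> K)}" for P
  proof (rule bij_betw_same_card[of "\<lambda>I. I \<inter> nbr_colors v"], rule bij_betw_byWitness[where f' = "\<lambda>K. J \<union> K"])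
    show "\<forall>I\<in>{I \<in> indep A colors. I - nbr_colors v = J \<and> P I}. J \<union> I \<inter> nbr_colors v = I" by auto
    show "\<forall>K\<in>{K \<in> indep A Z. P (J \<union> K)}. (J \<union> K) \<inter> nbr_colors v = K"
      using ZY indepD(1)[OF J] by (auto dest!: indepD(1))
    show "(\<lambda>I. I \<inter> nbr_colors v) ` {I \<in> indep A colors. I - nbr_colors v = J \<and> P I} \<subseteq> {K \<in> indep A Z. P (J \<union> K)}"
    proof clarify
      fix I assume I: "I \<in> indep A colors" "J = I - nbr_colors v" "P I"
      have "J \<union> I \<inter> nbr_colors v = I" using I(2) by auto
      moreover have "I \<inter> nbr_colors v \<in> indep A Z"
        using I(1,2) unfolding Z_def indep_def by auto
      ultimately show "I \<inter> nbr_colors v \<in> indep A Z \<and> P (I - nbr_colors v \<union> I \<inter> nbr_colors v)" using I by simp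
    qed
    show "(\<lambda>K. J \<union> K) ` {K \<in> indep A Z. P (J \<union> K)} \<subseteq> {I \<in> indep A colors. I - nbr_colors v = J \<and> P I}"
    proof clarify
      fix K assume K: "K \<in> indep A Z" "P (J \<union> K)"
      have KZ: "K \<subseteq> Z" using indepD(1)[OF K(1)] .
      have "\<not> A x y" if "x \<in> J \<union> K" "y \<in> J \<union> K" for x y
        using that indepD(2)[OF J] indepD(2)[OF K(1)] KZ A_sym[of x y] unfolding Z_def by blast
      then have "J \<union> K \<in> indep A colors"
        using KZ ZY nbr_colors_subset indepD(1)[OF J] unfolding indep_def by blast
      moreover have "J \<union> K - nbr_colors v = J" using KZ ZY indepD(1)[OF J] by blast
      ultimately show "J \<union> K \<in> indep A colors \<and> J \<union> K - nbr_colors v = J \<and> P (J \<union> K)" using K by blast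
    qed
  qed
  let ?conflicts = "\<lambda>x. conflicts v x \<inter> Z"
  have MZ: "(J \<union> K) \<inter> conflicts v x = K \<inter> ?conflicts x" if "K \<in> indep A Z" for K x
    using indepD(1)[OF J] indepD(1)[OF that] conflicts_subset[of v x] by blast
  \<comment> \<open>Membership in \<open>Z\<close> already accounts for the neighbors in
    \<open>J\<close>.\<close>
  have rv: "rivals v x (J \<union> K) = {y \<in> ?conflicts x. \<forall>z\<in>K. \<not> A y z}" for x K
    unfolding rivals_def Z_def using conflicts_subset[of v x] by blast
  have free: "clique_free A r (?conflicts x)" if "x \<in> L v" for x
    using clique_free_mono[OF conflicts_clique_free[OF v that]] by simp
  let ?B0 = "{K \<in> indep A Z. real (card {x \<in> L v. K \<inter> ?conflicts x = {}}) < ?p * k / 8}"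
  let ?B1 = "\<lambda>x. {K \<in> indep A Z. K \<inter> ?conflicts x = {} \<and>
    exp (lam / 4) < real (card {y \<in> ?conflicts x. \<forall>z\<in>K. \<not> A y z})}"
  have av: "available v (J \<union> K) = {x \<in> L v. K \<inter> ?conflicts x = {}}" if "K \<in> indep A Z" for K
    unfolding available_def MZ[OF that] by simp
  have "{K \<in> indep A Z. J \<union> K \<in> bad lam v} \<subseteq> ?B0 \<union> (\<Union>x\<in>L v. ?B1 x)"
    unfolding bad_def using av by (auto simp: rv)
  then have "card {K \<in> indep A Z. J \<union> K \<in> bad lam v} \<le> card (?B0 \<union> (\<Union>x\<in>L v. ?B1 x))"
    using finZ finL[OF v] by (intro card_mono) auto
  also have "\<dots> \<le> card ?B0 + card (\<Union>x\<in>L v. ?B1 x)" by (rule card_Un_le)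
  also have "card (\<Union>x\<in>L v. ?B1 x) \<le> (\<Sum>x\<in>L v. card (?B1 x))"
    using finL[OF v] by (rule card_UN_le)
  finally have "real (card {K \<in> indep A Z. J \<union> K \<in> bad lam v}) \<le>
      real (card ?B0 + (\<Sum>x\<in>L v. card (?B1 x)))"
    by (simp only: of_nat_le_iff add_left_mono)
  also have "\<dots> = real (card ?B0) + (\<Sum>x\<in>L v. real (card (?B1 x)))" by simp
  also have "\<dots> \<le> exp (- ?p * k / 8) * card (indep A Z) +
      (\<Sum>x\<in>L v. exp (- 10 * lam) * card (indep A Z))"
  proof (intro add_mono sum_mono)
    have "real (card {K \<in> indep A Z. real (card {x \<in> L v. K \<inter> ?conflicts x = {}}) < ?p * card (L v) / 8})
        \<le> exp (- ?p * card (L v) / 8) * card (indep A Z)"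
    proof (rule few_available_rare[OF finZ A_sym A_irrefl r mu _ ra refl a finL[OF v]])
      show "?conflicts x \<inter> ?conflicts y = {}" if "x \<in> L v" "y \<in> L v" "x \<noteq> y" for x y
        using conflicts_disjoint[OF v that] by blast
      show "card I \<le> D" if "I \<in> indep A Z" for I using indep_size[OF v ZY that] .
      show "8 * D \<le> a * card (L v)" using ak cardL[OF v] by simp
    qed (use free lam in auto)
    then show "real (card ?B0) \<le> exp (- ?p * k / 8) * card (indep A Z)"
      unfolding cardL[OF v] .
    show "real (card (?B1 x)) \<le> exp (- 10 * lam) * card (indep A Z)" if "x \<in> L v" for x
      by (rule free_large_rare[OF finZ A_sym A_irrefl r mu lam rm _ free[OF that]]) auto
  qed
  also have "\<dots> = (exp (- ?p * k / 8) + k * exp (- 10 * lam)) * card (indep A Z)"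
    using cardL[OF v] by (simp add: algebra_simps)
  finally have "real (card {K \<in> indep A Z. J \<union> K \<in> bad lam v}) \<le>
      (exp (- ?p * k / 8) + k * exp (- 10 * lam)) * card (indep A Z)" .
  then show ?thesis
    using cls[of "\<lambda>I. I \<in> bad lam v"] cls[of "\<lambda>_. True"] unfolding J_def by simp
qed

text \<open>A configuration avoiding all bad events colors the vertices outside \<open>U\<close>.
  For the others, the remaining lists are long compared with the number of conflicts per color, with
  ratio \<open>4\<close> by \<open>lists\<close>, so the counting lemma completes the
  coloring.\<close>

theorem colorable:
  fixes lam mu :: real
  assumes r: "r > 0" and D: "D > 0" and mu: "mu = ln lam" "mu \<ge> 1"
    and lam: "lam \<ge> 32" and ra: "real r * real a * mu \<le> lam / 8" and a: "a > 0"
    and ak: "8 * D \<le> a * k" and rm: "real r * mu \<le> lam / 32"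
    and lists: "4 * exp (lam / 4) \<le> exp (- lam / 2) * k / 8"
    and prob: "8 * real D ^ 3 * (exp (- exp (- lam / 2) * k / 8) + k * exp (- 10 * lam)) \<le> 1"
  shows "\<exists>\<psi>. \<forall>u\<in>V. \<psi> u \<in> L u \<and> (\<forall>v\<in>V. \<not> A (\<psi> u) (\<psi> v))"
proof -
  let ?q = "exp (- exp (- lam / 2) * k / 8) + k * exp (- 10 * lam)"
  have "\<exists>I\<in>indep A colors. \<forall>v\<in>V. I \<notin> bad lam v"
  \<comment> \<open>Resampling \<open>v\<close> redraws the colors of its neighbors. As
    \<open>ball v\<close> has at most \<open>2 * D ^ 3\<close> elements, the numerical condition of
    the local lemma is \<open>prob\<close>.\<close>
  proof (rule lopsided_local_lemma[where c = "\<lambda>v I. I - nbr_colors v" and \<Gamma> = ball and D = "2 * D ^ 3" and p = ?q])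
    show "card (ball v) \<le> 2 * D ^ 3" if "v \<in> V" for v using card_ball_le[OF that D] .
    show "real (card {I' \<in> indep A colors. I' - nbr_colors v = I - nbr_colors v \<and> I' \<in> bad lam v})
        \<le> ?q * card {I' \<in> indep A colors. I' - nbr_colors v = I - nbr_colors v}" if "v \<in> V" "I \<in> indep A colors" for v I
      using card_bad_le[OF that r mu lam ra a ak rm] .
    show "4 * ?q * real (2 * D ^ 3) \<le> 1" using prob by (simp add: algebra_simps)
    show "indep A colors \<noteq> {}" using empty_in_indep by blast
    show "I' \<in> bad lam w" if "v \<in> V" "w \<in> V" "w \<notin> ball v" "I \<in> indep A colors" "I' \<in> indep A colors"
      "I - nbr_colors v = I' - nbr_colors v" "I \<in> bad lam w" for v w I I'
      using bad_local[OF that] .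
  qed (use finV finite_colors finite_ball D in \<open>auto intro: add_nonneg_nonneg\<close>)
  then obtain I where I: "I \<in> indep A colors" and good: "\<And>v. v \<in> V \<Longrightarrow> I \<notin> bad lam v" by blast
  define U where "U = {u \<in> V. I \<inter> L u = {}}"
  define L' where "L' u = {x \<in> L u. \<forall>z\<in>I. \<not> A x z}" for u
  \<comment> \<open>Since \<open>u\<close> is uncolored, any color of \<open>I\<close> adjacent to a
    color of \<open>u\<close> belongs to a neighbor of \<open>u\<close>, hence to a conflict set
    that \<open>I\<close> avoids.\<close>
  have av: "available u I \<subseteq> L' u" if u: "u \<in> U" for u
  proof
    fix x assume x: "x \<in> available u I"
    have xL: "x \<in> L u" using x unfolding available_def by simp
    have uV: "u \<in> V" using u unfolding U_def by simp
    have "\<not> A x z" if z: "z \<in> I" for z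
    proof
      assume Axz: "A x z"
      obtain t where t: "t \<in> V" "z \<in> L t" using z indepD(1)[OF I] unfolding colors_def by blast
      have "t \<noteq> u" using t z u unfolding U_def by blast
      then have "E u t" using A_edge[OF uV t(1) xL t(2) Axz] by blast
      then have "z \<in> I \<inter> conflicts u x" using t z Axz unfolding conflicts_def nbr_colors_def by blast
      then show False using x unfolding available_def by blast
    qed
    then show "x \<in> L' u" using xL unfolding L'_def by blast
  qed
  have "\<exists>\<phi>. \<forall>u\<in>U. \<phi> u \<in> L' u \<and> (\<forall>v\<in>U. v \<noteq> u \<longrightarrow> \<not> A (\<phi> u) (\<phi> v))"
  proof (rule proper_choice_exists[where s = "exp (- lam / 2) * k / 8" and d = "exp (lam / 4)"])
    show "finite U" using finV unfolding U_def by simp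
    show finL': "finite (L' u)" if "u \<in> U" for u using that finL unfolding U_def L'_def by simp
    show "exp (- lam / 2) * k / 8 \<le> real (card (L' u))" if u: "u \<in> U" for u
    proof -
      have "exp (- lam / 2) * k / 8 \<le> real (card (available u I))"
        using good[of u] u unfolding bad_def U_def by auto
      also have "\<dots> \<le> real (card (L' u))" using card_mono[OF finL'[OF u] av[OF u]] by simp
      finally show ?thesis .
    qed
    show "4 * exp (lam / 4) \<le> exp (- lam / 2) * k / 8" by (rule lists)
    have "0 < 4 * exp (lam / 4)" by simp
    then show "0 < exp (- lam / 2) * k / 8" using lists by linarith
    show "real (card {(v, y). v \<in> U \<and> v \<noteq> u \<and> y \<in> L' v \<and> A x y}) \<le> exp (lam / 4)"
      if u: "u \<in> U" and x: "x \<in> L' u" for u x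
    proof -
      let ?S = "{(v, y). v \<in> U \<and> v \<noteq> u \<and> y \<in> L' v \<and> A x y}"
      have uV: "u \<in> V" using u unfolding U_def by simp
      \<comment> \<open>A remaining color has no neighbor in \<open>I\<close>, so it is available,
        and its conflicts with other remaining colors are among its rivals.\<close>
      have "x \<in> available u I"
        using x unfolding L'_def available_def conflicts_def by blast
      then have le: "real (card (rivals u x I)) \<le> exp (lam / 4)"
        using good[OF uV] unfolding bad_def by force
      have "card ?S \<le> card (rivals u x I)"
      proof (rule card_inj_on_le[of snd])
        show "inj_on snd ?S" unfolding U_def L'_def by (auto simp: inj_on_def intro: disj)
        show "snd ` ?S \<subseteq> rivals u x I"
        proof clarify
          fix v y assume *: "v \<in> U" "v \<noteq> u" "y \<in> L' v" "A x y"
          then have "v \<in> V" "y \<in> L v" "x \<in> L u" using x unfolding U_def L'_def by auto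
          then have "E u v" using A_edge[of u v x y] uV * by blast
          then show "snd (v, y) \<in> rivals u x I"
            using * unfolding rivals_def conflicts_def nbr_colors_def L'_def by auto
        qed
        show "finite (rivals u x I)"
          using finite_subset[OF conflicts_subset finite_nbr_colors] unfolding rivals_def by simp
      qed
      then show ?thesis using le by linarith
    qed
  qed (rule A_sym)
  then obtain \<phi> where \<phi>: "\<And>u. u \<in> U \<Longrightarrow> \<phi> u \<in> L' u"
    "\<And>u v. u \<in> U \<Longrightarrow> v \<in> U \<Longrightarrow> v \<noteq> u \<Longrightarrow> \<not> A (\<phi> u) (\<phi> v)" by blast
  have "\<forall>u. \<exists>x. u \<in> V - U \<longrightarrow> x \<in> I \<inter> L u" unfolding U_def by blast
  then obtain \<chi> where \<chi>: "\<And>u. u \<in> V - U \<Longrightarrow> \<chi> u \<in> I \<inter> L u" by metis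
  define \<psi> where "\<psi> u = (if u \<in> U then \<phi> u else \<chi> u)" for u
  have no: "\<not> A (\<phi> u) (\<chi> v)" "\<not> A (\<chi> v) (\<phi> u)" if "u \<in> U" "v \<in> V - U" for u v
    using \<phi>(1)[OF that(1)] \<chi>[OF that(2)] A_sym unfolding L'_def by blast+
  have "\<psi> u \<in> L u \<and> (\<forall>v\<in>V. \<not> A (\<psi> u) (\<psi> v))" if u: "u \<in> V" for u
  proof (intro conjI ballI)
    show "\<psi> u \<in> L u" using \<phi>(1)[of u] \<chi>[of u] u unfolding \<psi>_def L'_def by auto
    fix v assume v: "v \<in> V"
    show "\<not> A (\<psi> u) (\<psi> v)"
    proof (cases "u = v")
      case True
      then show ?thesis using A_irrefl by simp
    next
      case False
      then show ?thesis
        using \<phi>(2)[of u v] no \<chi>[of u] \<chi>[of v] indepD(2)[OF I] u v unfolding \<psi>_def by auto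
    qed
  qed
  then show ?thesis by blast
qed

text \<open>The counting lemma on the full lists, where a color has at most one conflict per
  neighbor. It serves for bounded \<open>D\<close> and for \<open>r\<close> so large that the list
  size reaches \<open>4 * D\<close>.\<close>

theorem colorable_greedy:
  assumes "4 * D \<le> k" "k > 0"
  shows "\<exists>\<psi>. \<forall>u\<in>V. \<psi> u \<in> L u \<and> (\<forall>v\<in>V. \<not> A (\<psi> u) (\<psi> v))"
proof -
  have "\<exists>\<psi>. \<forall>u\<in>V. \<psi> u \<in> L u \<and> (\<forall>v\<in>V. v \<noteq> u \<longrightarrow> \<not> A (\<psi> u) (\<psi> v))"
  proof (rule proper_choice_exists[where s = "real k" and d = "real D"])
    show "real (card {(v, y). v \<in> V \<and> v \<noteq> u \<and> y \<in> L v \<and> A x y}) \<le> real D"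
      if u: "u \<in> V" and x: "x \<in> L u" for u x
    proof -
      let ?S = "{(v, y). v \<in> V \<and> v \<noteq> u \<and> y \<in> L v \<and> A x y}"
      have S: "E u v" "y \<in> L v" "A x y" if "(v, y) \<in> ?S" for v y
        using A_edge[OF u _ x, of v y] that by auto
      have "inj_on fst ?S"
      proof (rule inj_onI, clarify)
        fix v y v' y' assume "v \<in> V" "v \<noteq> u" "y \<in> L v" "A x y" "y' \<in> L v'" "A x y'" "fst (v, y) = fst (v', y')"
        then show "v = v' \<and> y = y'" using A_match[OF _ x, of v y y'] S(1)[of v y] by auto
      qed
      moreover have "fst ` ?S \<subseteq> nbrs u" using S(1) by auto
      ultimately have "card ?S \<le> card (nbrs u)" using finite_nbrs by (rule card_inj_on_le)
      then show ?thesis using deg[OF u] by simp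
    qed
  qed (use assms finV finL cardL A_sym in auto)
  then show ?thesis using A_irrefl by metis
qed

end

section \<open>The bound on the DP-chromatic number\<close>

lemma list_cover_of_fold_cover:
  assumes G: "pair_graph G" and free: "complete_free r G" and cov: "fold_cover k G L H"
  shows "list_cover (pverts G) (\<lambda>u v. (u, v) \<in> parcs G) L (\<lambda>x y. (x, y) \<in> parcs H) k (max_degree G) r"
proof -
  from cov have c: "dp_cover G L H" and k: "\<And>u. u \<in> pverts G \<Longrightarrow> card (L u) = k"
    by (auto simp: fold_cover_def)
  from c have H: "pair_graph H"
    and c1: "disjoint_family_on L (pverts G)" and c2: "(\<Union>u\<in>pverts G. L u) = pverts H"
    and c3: "\<And>u x y. \<lbrakk>u \<in> pverts G; x \<in> L u; y \<in> L u; x \<noteq> y\<rbrakk> \<Longrightarrow> (x, y) \<in> parcs H"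
    and c4: "\<And>u v x y. \<lbrakk>u \<in> pverts G; v \<in> pverts G; x \<in> L u; y \<in> L v; (x, y) \<in> parcs H\<rbrakk>
      \<Longrightarrow> u = v \<or> (u, v) \<in> parcs G"
    and c5: "\<And>u v x y x' y'. \<lbrakk>(u, v) \<in> parcs G; x \<in> L u; y \<in> L v; x' \<in> L u; y' \<in> L v;
      (x, y) \<in> parcs H; (x', y') \<in> parcs H\<rbrakk> \<Longrightarrow> x = x' \<longleftrightarrow> y = y'"
    unfolding dp_cover_iff[OF G] by simp_all (elim conjE, blast)
  have Gfin: "finite (pverts G)" and Garc: "\<And>u v. (u, v) \<in> parcs G \<Longrightarrow> u \<in> pverts G \<and> v \<in> pverts G"
    and Gsym: "\<And>u v. (u, v) \<in> parcs G \<Longrightarrow> (v, u) \<in> parcs G"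
    using G by (auto simp: pair_graph_iff)
  have Hfin: "finite (pverts H)" and Hsym: "\<And>x y. (x, y) \<in> parcs H \<Longrightarrow> (y, x) \<in> parcs H \<and> x \<noteq> y"
    using H by (auto simp: pair_graph_iff)
  show ?thesis
  proof
    show "finite (pverts G)" by fact
    show "card {v. (u, v) \<in> parcs G} \<le> max_degree G" if u: "u \<in> pverts G" for u
    proof -
      have "out_arcs (with_proj G) u = Pair u ` {v. (u, v) \<in> parcs G}"
        by (auto simp: out_arcs_def with_proj_def)
      then have "out_degree (with_proj G) u = card {v. (u, v) \<in> parcs G}"
        unfolding out_degree_def by (simp add: card_image inj_on_def)
      moreover have "out_degree (with_proj G) u \<le> max_degree G"
        unfolding max_degree_def using Gfin u by (intro Max_ge) auto
      ultimately show ?thesis by simp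
    qed
    show "clique_free (\<lambda>u v. (u, v) \<in> parcs G) r (pverts G)"
      unfolding clique_free_def
    proof (intro allI impI, rule ccontr)
      fix Q assume Q: "Q \<subseteq> pverts G" "finite Q" "card Q = r"
        "\<not> (\<exists>x\<in>Q. \<exists>y\<in>Q. x \<noteq> y \<and> (x, y) \<notin> parcs G)"
      then have "complete_digraph r (with_proj G \<restriction> Q)"
        using complete_induced_iff[OF G Q(1)] by auto
      moreover have "subgraph (with_proj G \<restriction> Q) (with_proj G)"
      proof -
        interpret pair_graph G by fact
        show ?thesis using Q(1) by (intro subgraph_induce_subgraphI) simp
      qed
      ultimately show False using free unfolding complete_free_def by blast
    qed
    show "finite (L u)" if "u \<in> pverts G" for u
      using c2 that by (intro finite_subset[OF _ Hfin]) auto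
    show "u = v" if "u \<in> pverts G" "v \<in> pverts G" "x \<in> L u" "x \<in> L v" for u v x
      using c1 that unfolding disjoint_family_on_def by blast
    show "y = y'" if "(u, v) \<in> parcs G" "x \<in> L u" "y \<in> L v" "y' \<in> L v"
      "(x, y) \<in> parcs H" "(x, y') \<in> parcs H" for u v x y y'
      using c5[OF that(1,2,3,2,4,5,6)] by simp
  qed (use Garc Gsym Hsym k c3 c4 in blast)+
qed

lemma dp_coloring_of_choice:
  assumes G: "pair_graph G" and cov: "fold_cover k G L H"
    and \<psi>: "\<And>u. u \<in> pverts G \<Longrightarrow> \<psi> u \<in> L u"
      "\<And>u v. u \<in> pverts G \<Longrightarrow> v \<in> pverts G \<Longrightarrow> (\<psi> u, \<psi> v) \<notin> parcs H"
  shows "dp_coloring G H (\<psi> ` pverts G)"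
proof -
  have c: "disjoint_family_on L (pverts G)" "(\<Union>u\<in>pverts G. L u) = pverts H"
    using cov unfolding fold_cover_def dp_cover_iff[OF G] by auto
  have "inj_on \<psi> (pverts G)"
    using \<psi>(1) c(1) unfolding inj_on_def disjoint_family_on_def by (metis IntI empty_iff)
  moreover have "independent_set H (\<psi> ` pverts G)"
    using \<psi> c(2) unfolding independent_set_def by blast
  ultimately show ?thesis unfolding dp_coloring_def by (simp add: card_image)
qed

text \<open>This amounts to \<open>exp 1 < 3\<close>, which comes from
  \<open>1 / 3 < (1 - 1 / 8) ^ 8 \<le> exp (-1)\<close>. It keeps \<open>ln ln \<Delta>\<close> away
  from zero for \<open>\<Delta> \<ge> 3\<close>.\<close>

lemma ln_ln_3_pos: "ln (ln (3::real)) > 0"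
proof -
  have "(1::real) / 3 < (7 / 8) ^ 8" by (simp add: power_divide)
  also have "\<dots> \<le> exp (- (1 / 8)) ^ 8"
    using exp_ge_add_one_self[of "- (1 / 8) :: real"] by (intro power_mono) auto
  also have "\<dots> = exp (-1)" by (simp add: exp_of_nat_mult[symmetric])
  finally have "exp 1 < (3::real)" by (simp add: exp_minus field_simps)
  then have "1 < ln (3::real)" using ln_less_cancel_iff[of "exp 1" 3] by simp
  then show ?thesis by simp
qed

text \<open>Squaring \<open>lam / 8 \<le> exp (lam / 8)\<close> gives \<open>lam * lam / 64\<close>,
  which is at least \<open>32 * lam\<close> from \<open>lam = 32 * 64 = 2048\<close> on.\<close>

lemma exp_quarter_ge:
  fixes lam :: real
  assumes "lam \<ge> 2048"
  shows "32 * lam \<le> exp (lam / 4)"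
proof -
  have le: "lam / 8 \<le> exp (lam / 8)" using exp_ge_add_one_self[of "lam / 8"] by linarith
  have "32 * lam \<le> (lam / 8) * (lam / 8)" using mult_right_mono[OF assms, of lam] assms by simp
  also have "\<dots> \<le> exp (lam / 8) * exp (lam / 8)"
    using le assms by (intro mult_mono) auto
  also have "\<dots> = exp (lam / 4)" by (simp add: exp_add[symmetric])
  finally show ?thesis .
qed

text \<open>These are the last two hypotheses of \<open>colorable\<close> for
  \<open>D = exp lam\<close>. The lower bound on \<open>k\<close> makes many colors available; the
  upper one controls the union over the colors of a list.\<close>

lemma list_size_bounds:
  fixes lam k :: real
  assumes lam: "lam \<ge> 2048" and k: "exp lam / lam \<le> k" "k \<le> 4 * exp lam"
  shows "4 * exp (lam / 4) \<le> exp (- lam / 2) * k / 8"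
    and "8 * exp lam ^ 3 * (exp (- exp (- lam / 2) * k / 8) + k * exp (- 10 * lam)) \<le> 1"
proof -
  have q: "32 * lam \<le> exp (lam / 4)" using exp_quarter_ge[OF lam] .
  have "4 * exp (lam / 4) * lam * 8 \<le> exp (lam / 4) * exp (lam / 4)"
    using mult_left_mono[OF q, of "exp (lam / 4)"] by (simp add: mult_ac)
  also have "\<dots> = exp (- lam / 2) * exp lam" by (simp add: exp_add[symmetric])
  finally have "4 * exp (lam / 4) \<le> exp (- lam / 2) * (exp lam / lam) / 8"
    using lam by (simp add: field_simps)
  also have "\<dots> \<le> exp (- lam / 2) * k / 8"
    using k(1) by (intro divide_right_mono mult_left_mono) auto
  finally show lists: "4 * exp (lam / 4) \<le> exp (- lam / 2) * k / 8" .
  have small: "exp (- 5 * lam) \<le> 1 / 64"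
  proof -
    have "64 \<le> 1 + 5 * lam" using lam by simp
    also have "\<dots> \<le> exp (5 * lam)" by (rule exp_ge_add_one_self)
    finally show ?thesis by (simp add: exp_minus field_simps)
  qed
  have cube: "exp lam ^ 3 = exp (3 * lam)" using exp_of_nat_mult[of 3 lam] by simp
  \<comment> \<open>By \<open>lists\<close> and \<open>q\<close>, the quantity
    \<open>exp (- lam / 2) * k / 8\<close> is at least \<open>128 * lam\<close>.\<close>
  have "exp (- exp (- lam / 2) * k / 8) \<le> exp (- 8 * lam)"
    using lists q lam by simp
  moreover have "k * exp (- 10 * lam) \<le> 4 * exp lam * exp (- 10 * lam)"
    using k(2) by (intro mult_right_mono) auto
  ultimately have "8 * exp lam ^ 3 * (exp (- exp (- lam / 2) * k / 8) + k * exp (- 10 * lam))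
      \<le> 8 * exp (3 * lam) * (exp (- 8 * lam) + 4 * exp lam * exp (- 10 * lam))"
    unfolding cube by (intro mult_left_mono add_mono) auto
  also have "\<dots> = 8 * exp (- 5 * lam) + 32 * exp (- 6 * lam)"
    by (simp add: algebra_simps exp_add[symmetric])
  also have "\<dots> \<le> 8 * exp (- 5 * lam) + 32 * exp (- 5 * lam)" using lam by simp
  also have "\<dots> \<le> 1" using small by simp
  finally show "8 * exp lam ^ 3 * (exp (- exp (- lam / 2) * k / 8) + k * exp (- 10 * lam)) \<le> 1" .
qed

theorem (in list_cover) colorable_large:
  assumes r: "r > 0" and D: "ln (real D) \<ge> 2048"
    and k: "192 * (real r * real D * ln (ln (real D)) / ln (real D)) \<le> real k"
  shows "\<exists>\<psi>. \<forall>u\<in>V. \<psi> u \<in> L u \<and> (\<forall>v\<in>V. \<not> A (\<psi> u) (\<psi> v))"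
proof -
  define lam mu where "lam = ln (real D)" and "mu = ln lam"
  have lam: "lam \<ge> 2048" using D unfolding lam_def .
  have D0: "D > 0"
  proof (rule ccontr)
    assume "\<not> D > 0"
    \<comment> \<open>The convention \<open>ln 0 = 0\<close> excludes \<open>D = 0\<close>.\<close>
    then show False using D by simp
  qed
  have De: "real D = exp lam" unfolding lam_def using D0 by simp
  have mu: "mu \<ge> 1"
  proof -
    have "exp 1 \<le> lam" using exp_le lam by linarith
    then have "ln (exp 1) \<le> ln lam" using lam by (subst ln_le_cancel_iff) auto
    then show ?thesis unfolding mu_def by simp
  qed
  have k': "192 * (real r * real D * mu) \<le> real k * lam"
    using k lam unfolding lam_def[symmetric] mu_def[symmetric] by (simp add: field_simps)
  have "1 * real D \<le> (192 * (real r * mu)) * real D"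
  proof (rule mult_right_mono)
    have "1 * 1 \<le> real r * mu" using r mu by (intro mult_mono) auto
    then show "1 \<le> 192 * (real r * mu)" by simp
  qed simp
  with k' have "real D \<le> real k * lam" by (simp add: mult_ac)
  then have kD: "exp lam / lam \<le> real k" using lam De by (simp add: field_simps)
  have "exp lam / lam > 0" using lam by simp
  with kD have k0: "real k > 0" by linarith
  \<comment> \<open>If \<open>k < 4 * D\<close>, then \<open>k'\<close> bounds \<open>r * mu\<close>
    by a multiple of \<open>lam\<close>; values of \<open>r\<close> that are too large thus fall
    under the greedy case.\<close>
  show ?thesis
  proof (cases "4 * D \<le> k")
    case True
    then show ?thesis using colorable_greedy k0 by simp
  next
    case False
    then have k4: "real k < 4 * real D" by linarith
    \<comment> \<open>The least integer with \<open>8 * D \<le> a * k\<close>. As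
      \<open>k < 4 * D\<close>, rounding up costs at most \<open>4 * D\<close>, so
      \<open>a * k \<le> 12 * D\<close>, and \<open>192 / 12 = 16\<close> yields
      \<open>ra\<close>.\<close>
    define a where "a = nat \<lceil>8 * real D / real k\<rceil>"
    have a_ge: "8 * real D / real k \<le> real a" unfolding a_def by linarith
    have q0: "8 * real D / real k > 0" using D0 k0 by simp
    then have a_le: "real a \<le> 8 * real D / real k + 1" unfolding a_def by linarith
    have a0: "a > 0" using a_ge q0 by (cases a) auto
    have "8 * real D \<le> real a * real k" using a_ge k0 by (simp add: field_simps)
    then have "real (8 * D) \<le> real (a * k)" by simp
    then have ak: "8 * D \<le> a * k" by (simp only: of_nat_le_iff)
    have "real a * real k \<le> 8 * real D + real k"
      using mult_right_mono[OF a_le, of "real k"] k0 by (simp add: algebra_simps)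
    then have ak': "real a * real k \<le> 12 * real D" using k4 by simp
    have "192 * (real r * real D * mu) * real a \<le> real k * lam * real a"
      using k' by (rule mult_right_mono) simp
    also have "\<dots> = (real a * real k) * lam" by simp
    also have "\<dots> \<le> 12 * real D * lam" using ak' lam by (intro mult_right_mono) auto
    finally have "real D * (16 * (real r * real a * mu)) \<le> real D * lam" by (simp add: mult_ac)
    then have ra: "16 * (real r * real a * mu) \<le> lam" using D0 by simp
    have "real k * lam \<le> 4 * real D * lam" using k4 lam by (intro mult_right_mono) auto
    with k' have "real D * (48 * (real r * mu)) \<le> real D * lam" by (simp add: mult_ac)
    then have rm: "48 * (real r * mu) \<le> lam" using D0 by simp
    have rm0: "real r * mu \<ge> 0" and ram0: "real r * real a * mu \<ge> 0" using mu by auto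
    show ?thesis
    proof (rule colorable[OF r D0 mu_def mu _ _ a0 ak])
      show "4 * exp (lam / 4) \<le> exp (- lam / 2) * real k / 8"
        using list_size_bounds(1)[OF lam kD] k4 De by simp
      show "8 * real D ^ 3 * (exp (- exp (- lam / 2) * real k / 8) + real k * exp (- 10 * lam)) \<le> 1"
        unfolding De using list_size_bounds(2)[OF lam kD] k4 De by simp
    qed (use lam ra rm rm0 ram0 in auto)
  qed
qed

theorem theorem1p6:
  shows "\<exists>C :: real. C > 0 \<and>
    (\<forall>r :: nat. r \<ge> 4 \<longrightarrow>
      (\<forall>(G :: nat pair_pre_digraph) \<Delta> :: nat.
        pair_graph G \<and> complete_free r G \<and> max_degree G = \<Delta> \<and> \<Delta> \<ge> 3 \<longrightarrow>
          real (dp_chromatic_number G) \<le> C * (real r * real \<Delta> * ln (ln (real \<Delta>)) / ln (real \<Delta>))))"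
proof -
  \<comment> \<open>The summand \<open>384 = 2 * 192\<close> allows for rounding
    \<open>C * t\<close> down when \<open>t \<ge> 1\<close>. The other one makes lists long enough
    for the greedy case while \<open>ln \<Delta> < 2048\<close>, by
    \<open>ln ln \<Delta> \<ge> ln ln 3\<close>.\<close>
  define C :: real where "C = 384 + 5 * 2048 / ln (ln 3)"
  have C384: "C \<ge> 384" and C0: "C > 0" and C3: "5 * 2048 / ln (ln 3) \<le> C"
    unfolding C_def using ln_ln_3_pos by (auto intro: add_pos_pos)
  have "real (dp_chromatic_number G) \<le> C * (real r * real \<Delta> * ln (ln (real \<Delta>)) / ln (real \<Delta>))"
    if r: "r \<ge> 4" and G: "pair_graph G" and free: "complete_free r G"
      and max: "max_degree G = \<Delta>" and \<Delta>: "\<Delta> \<ge> 3"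
    for r \<Delta> :: nat and G :: "nat pair_pre_digraph"
  proof -
    define lam mu where "lam = ln (real \<Delta>)" and "mu = ln lam"
    define t where "t = real r * real \<Delta> * mu / lam"
    \<comment> \<open>The largest integer within the bound; since the DP-chromatic number is a
      minimum, coloring the \<open>k\<close>-fold covers for this single \<open>k\<close>
      suffices.\<close>
    define k where "k = nat \<lfloor>C * t\<rfloor>"
    have ln3: "ln 3 > (1::real)" using ln_ln_3_pos by (metis ln_gt_zero_iff ln_gt_zero one_less_numeral_iff semiring_norm(77))
    have lam3: "ln 3 \<le> lam" unfolding lam_def using \<Delta> by (subst ln_le_cancel_iff) auto
    then have lam1: "lam > 1" using ln3 by linarith
    have mu3: "ln (ln 3) \<le> mu" unfolding mu_def using lam3 lam1 ln3 by (subst ln_le_cancel_iff) auto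
    then have mu0: "mu > 0" using ln_ln_3_pos by linarith
    have t0: "t > 0" unfolding t_def using r \<Delta> lam1 mu0 by auto
    have kle: "real k \<le> C * t" unfolding k_def using t0 C0 by simp
    have kge: "C * t < real k + 1" unfolding k_def using t0 C0 by linarith
    have "\<exists>I. dp_coloring G H I" if cov: "fold_cover k G L H" for L :: "nat \<Rightarrow> nat set" and H
    proof -
      interpret list_cover "pverts G" "\<lambda>u v. (u, v) \<in> parcs G" L "\<lambda>x y. (x, y) \<in> parcs H" k \<Delta> r
        using list_cover_of_fold_cover[OF G free cov] unfolding max .
      have "\<exists>\<psi>. \<forall>u\<in>pverts G. \<psi> u \<in> L u \<and> (\<forall>v\<in>pverts G. (\<psi> u, \<psi> v) \<notin> parcs H)"
      proof (cases "lam \<ge> 2048")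
        case True
        have "lam \<le> real \<Delta>" unfolding lam_def using ln_le_minus_one[of "real \<Delta>"] \<Delta> by simp
        moreover have "1 \<le> mu"
        proof -
          have "exp 1 \<le> lam" using exp_le True by linarith
          then have "ln (exp 1) \<le> ln lam" using lam1 by (subst ln_le_cancel_iff) auto
          then show ?thesis unfolding mu_def by simp
        qed
        ultimately have "1 * lam \<le> (real r * mu) * real \<Delta>"
          using r lam1 mult_mono[of 1 "real r" 1 mu] by (intro mult_mono) auto
        then have "1 \<le> t" unfolding t_def using lam1 by (simp add: field_simps)
        moreover have "384 * t \<le> C * t" using C384 t0 by simp
        ultimately have "192 * t \<le> real k" using kge by linarith
        then show ?thesis
          using colorable_large r True unfolding t_def mu_def lam_def by simp
      next
        case False
        have "(5 * 2048 :: real) = 5 * 2048 / ln (ln 3) * ln (ln 3)" using ln_ln_3_pos by simp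
        also have "\<dots> \<le> C * mu" using C3 mu3 ln_ln_3_pos C0 by (intro mult_mono) auto
        also have "\<dots> \<le> C * mu * real r" using C0 mu0 r by simp
        finally have "5 * lam \<le> C * mu * real r" using False by linarith
        then have "5 * lam * real \<Delta> \<le> C * mu * real r * real \<Delta>" by (rule mult_right_mono) simp
        then have "5 * real \<Delta> \<le> C * t" unfolding t_def using lam1 by (simp add: field_simps)
        \<comment> \<open>The factor \<open>5\<close> in place of \<open>4\<close> absorbs the
          rounding of \<open>k\<close>.\<close>
        then have "4 * \<Delta> \<le> k" "k > 0" using kge \<Delta> by linarith+
        then show ?thesis by (rule colorable_greedy)
      qed
      then obtain \<psi> where "\<And>u. u \<in> pverts G \<Longrightarrow> \<psi> u \<in> L u"
        "\<And>u v. u \<in> pverts G \<Longrightarrow> v \<in> pverts G \<Longrightarrow> (\<psi> u, \<psi> v) \<notin> parcs H" by blast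
      then show ?thesis using dp_coloring_of_choice[OF G cov] by blast
    qed
    then have "dp_chromatic_number G \<le> k"
      unfolding dp_chromatic_number_def by (intro Least_le) blast
    then have "real (dp_chromatic_number G) \<le> C * t" using kle by linarith
    then show ?thesis unfolding t_def mu_def lam_def .
  qed
  then show ?thesis using C0 by blast
qed

end
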